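(* Let $H$ be a nonzero complex Hilbert space and let $A$ be a bounded positive (semidefinite) operator on $H$, $A\ge 0$. Then \[ \inf_{\|x\|=1}\Delta_x(A)=\inf_{\|x\|=1}\langle Ax,x\rangle=\inf\sigma(A), \qquad \sup_{\|x\|=1}\Delta_x(A)=\sup_{\|x\|=1}\langle Ax,x\rangle=\sup\sigma(A), \] where $\sigma(A)$ is the spectrum of $A$ and the infima and suprema are taken over unit vectors $x\in H$.
   Context: The inner product $\langle\cdot,\cdot\rangle$ is linear in the first variable and conjugate-linear in the second. $A\ge 0$ means $\langle Ax,x\rangle\ge 0$ for all $x\in H$; $A>0$ means $A$ is positive and invertible in $\mathcal B(H)$ (equivalently $A\ge mI$ for some $m>0$). Fujii--Seo (normalized) determinant: for $A>0$ and a unit vector $x$, $\Delta_x(A):=\exp(\langle(\log A)x,x\rangle)$. For $A\ge 0$ not necessarily invertible, set $\langle(\log A)x,x\rangle:=\lim_{\varepsilon\to0^+}\langle\log(A+\varepsilon I)x,x\rangle\in[-\infty,\infty)$ and $\Delta_x(A):=\exp(\langle(\log A)x,x\rangle)$ with $\exp(-\infty)=0$. Equivalently, $\langle(\log A)x,x\rangle=\int_{\sigma(A)}\log\lambda\,dE_x(\lambda)$ with $\log 0:=-\infty$, where $E$ is the spectral measure of $A$ and $E_x(\cdot)=\langle E(\cdot)x,x\rangle$. *)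

theory Defs
  imports
    "HOL-Analysis.Analysis"
    "HOL-Library.Nonpos_Ints"
    "HOL-Computational_Algebra.Polynomial"
begin

section \<open>Complex Hilbert spaces\<close>

text \<open>
  The inner product is linear in the first argument and conjugate-linear in the second. The
  underlying real normed space is the one given by restriction of scalars, so that
  \<^const>\<open>bounded_linear\<close>, \<^const>\<open>onorm\<close> and completeness are those of the library.
\<close>

class complex_inner = real_normed_vector +
  fixes scaleC :: "complex \<Rightarrow> 'a \<Rightarrow> 'a" (infixr "*\<^sub>C" 75)
    and cinner :: "'a \<Rightarrow> 'a \<Rightarrow> complex"
  assumes scaleC_add_right: "c *\<^sub>C (x + y) = c *\<^sub>C x + c *\<^sub>C y"
    and scaleC_add_left: "(c + d) *\<^sub>C x = c *\<^sub>C x + d *\<^sub>C x"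
    and scaleC_scaleC: "c *\<^sub>C d *\<^sub>C x = (c * d) *\<^sub>C x"
    and scaleC_of_real: "complex_of_real r *\<^sub>C x = r *\<^sub>R x"
    and cinner_add_left: "cinner (x + y) z = cinner x z + cinner y z"
    and cinner_scaleC_left: "cinner (c *\<^sub>C x) y = c * cinner x y"
    and cinner_commute: "cinner x y = cnj (cinner y x)"
    and cinner_self_nonneg: "cinner x x \<in> \<real>\<^sub>\<ge>\<^sub>0"
    and cinner_self_eq_zero_iff: "cinner x x = 0 \<longleftrightarrow> x = 0"
    and norm_eq_sqrt_cinner: "norm x = sqrt (Re (cinner x x))"

class chilbert_space = complex_inner + complete_space

section \<open>Bounded operators, positivity, spectrum\<close>

definition bounded_clinear :: "('a::complex_inner \<Rightarrow> 'a) \<Rightarrow> bool" where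
  "bounded_clinear T \<longleftrightarrow> bounded_linear T \<and> (\<forall>c x. T (c *\<^sub>C x) = c *\<^sub>C T x)"

definition positive_op :: "('a::complex_inner \<Rightarrow> 'a) \<Rightarrow> bool" where
  "positive_op T \<longleftrightarrow> (\<forall>x. cinner (T x) x \<in> \<real>\<^sub>\<ge>\<^sub>0)"

definition invertible_op :: "('a::complex_inner \<Rightarrow> 'a) \<Rightarrow> bool" where
  "invertible_op T \<longleftrightarrow> bounded_clinear T \<and>
     (\<exists>S. bounded_clinear S \<and> S \<circ> T = id \<and> T \<circ> S = id)"

definition spectrum :: "('a::complex_inner \<Rightarrow> 'a) \<Rightarrow> complex set" where
  "spectrum T = {z. \<not> invertible_op (\<lambda>x. T x - z *\<^sub>C x)}"

section \<open>Continuous functional calculus and logarithm\<close>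

definition poly_op :: "real poly \<Rightarrow> ('a::complex_inner \<Rightarrow> 'a) \<Rightarrow> 'a \<Rightarrow> 'a" where
  "poly_op p T x = (\<Sum>k\<le>degree p. coeff p k *\<^sub>R (T ^^ k) x)"

text \<open>
  For a self-adjoint \<open>T\<close>, whose spectrum is a compact subset of the real line, and a real function
  \<open>f\<close> continuous on it, \<open>f(T)\<close> is the limit in operator norm of \<open>p\<^sub>n(T)\<close> for any real polynomials
  \<open>p\<^sub>n\<close> that converge to \<open>f\<close> uniformly on the spectrum.
  The real part only serves to regard the spectrum as a set of reals.
\<close>

definition cfc :: "(real \<Rightarrow> real) \<Rightarrow> ('a::complex_inner \<Rightarrow> 'a) \<Rightarrow> 'a \<Rightarrow> 'a" where
  "cfc f T = (THE S. bounded_clinear S \<and>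
     (\<forall>p :: nat \<Rightarrow> real poly.
        uniform_limit (Re ` spectrum T) (\<lambda>n. poly (p n)) f sequentially \<longrightarrow>
        (\<lambda>n. onorm (\<lambda>x. poly_op (p n) T x - S x)) \<longlonglongrightarrow> 0))"

text \<open>Meaningful for positive invertible operators, whose spectrum lies in \<open>(0, \<infinity>)\<close>.\<close>

definition log_op :: "('a::complex_inner \<Rightarrow> 'a) \<Rightarrow> 'a \<Rightarrow> 'a" where
  "log_op T = cfc ln T"

section \<open>The normalized determinant\<close>

text \<open>
  The value \<open>\<langle>(log T)x, x\<rangle>\<close> in \<open>[-\<infinity>, \<infinity>)\<close> for a positive, not necessarily invertible \<open>T\<close>, as the
  limit of \<open>\<langle>log(T + \<epsilon>I)x, x\<rangle>\<close> as \<open>\<epsilon>\<close> decreases to 0. The inner products inside the limit are real,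
  because the logarithms are self-adjoint. If \<open>T\<close> is invertible, the limit is \<open>\<langle>(log T)x, x\<rangle>\<close>.
\<close>

definition log_form :: "('a::complex_inner \<Rightarrow> 'a) \<Rightarrow> 'a \<Rightarrow> ereal" where
  "log_form T x =
     Lim (at_right 0) (\<lambda>\<epsilon>::real. ereal (Re (cinner (log_op (\<lambda>y. T y + \<epsilon> *\<^sub>R y) x) x)))"

text \<open>
  The exponential with \<open>exp (-\<infinity>) = 0\<close>. The value at \<open>\<infinity>\<close> is a dummy: \<^const>\<open>log_form\<close> of a positive
  operator is never \<open>\<infinity>\<close>.
\<close>

definition exp_ereal :: "ereal \<Rightarrow> real" where
  "exp_ereal a = (if a = -\<infinity> then 0 else exp (real_of_ereal a))"

definition fs_det :: "('a::complex_inner \<Rightarrow> 'a) \<Rightarrow> 'a \<Rightarrow> real" where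
  "fs_det T x = exp_ereal (log_form T x)"

end

theory Submission
  imports Defs "HOL-Computational_Algebra.Fundamental_Theorem_Algebra"
begin

text \<open>
  Write \<open>m\<close> and \<open>M\<close> for the infimum and the supremum of \<open>\<langle>Ax, x\<rangle>\<close> over unit vectors. Both lie in \<open>\<sigma>(A)\<close>, and
  \<open>\<sigma>(A) \<subseteq> [m, M]\<close>: an operator with coercive form is invertible (\<open>coercive_imp_invertible\<close>), and a
  positive invertible operator is coercive (\<open>invertible_positive_imp_coercive\<close>).

  For the determinant three inequalities are enough, each from an inequality between functions on the spectrum of \<open>A +
  \<epsilon>I\<close> whose consequence survives \<open>\<epsilon> \<rightarrow> 0\<close>. If \<open>m > 0\<close>, then
  \<open>ln t \<ge> ln m\<close> gives \<open>m \<le> \<Delta>\<^sub>x(A)\<close>, which is trivial for \<open>m = 0\<close>.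
  The tangent of \<open>ln\<close> at the mean value gives Jensen's inequality \<open>\<Delta>\<^sub>x(A) \<le> \<langle>Ax,
  x\<rangle>\<close>. These settle the infimum and one half of the supremum. A vector \<open>y\<close> with
  \<open>\<langle>Ay, y\<rangle>\<close> close to \<open>M\<close> need not have a determinant close to \<open>M\<close>,
  since a small component of \<open>y\<close> near the kernel can make \<open>\<langle>(log A)y, y\<rangle>\<close> very
  negative. The vector \<open>x = Ay/\<parallel>Ay\<parallel>\<close> does: with \<open>c = \<parallel>Ay\<parallel>\<close>,
  integrating \<open>t\<^sup>2 (ln t - ln c) \<ge> (t\<^sup>2 - c\<^sup>2)/2\<close> against the spectral measure of
  \<open>y\<close> gives \<open>\<Delta>\<^sub>x(A) \<ge> \<parallel>Ay\<parallel> \<ge> \<langle>Ay, y\<rangle>\<close>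
  (\<open>log_value_range_ge\<close>).

  No spectral measure is constructed. Scalar inequalities are transferred through polynomials
  (\<open>poly_op_form_nonneg\<close>, \<open>cfc_form_nonneg\<close>): a real polynomial that is nonnegative on \<open>\<sigma>(T)\<close> has a positive
  semidefinite value at a self-adjoint \<open>T\<close>, because a polynomial without zeros in \<open>\<sigma>(T)\<close> has an invertible
  value, while the infimum of the form of \<open>p(T)\<close> lies in the spectrum of \<open>p(T)\<close>.
  The resulting bound \<open>\<parallel>p(T)\<parallel> \<le> sup |p|\<close> over \<open>\<sigma>(T)\<close> also makes the functional calculus well defined.
\<close>

section \<open>Inner products and self-adjointness\<close>

lemma cinner_add_right: "cinner x (y + z) = cinner x y + cinner x z"
  using cinner_add_left[of y z x] cinner_commute complex_cnj_add by metis

lemma cinner_scaleC_right: "cinner x (c *\<^sub>C y) = cnj c * cinner x y"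
  using cinner_scaleC_left[of c y x] cinner_commute complex_cnj_mult by metis

lemma cinner_scaleR_left: "cinner (r *\<^sub>R x) y = of_real r * cinner x y"
  by (metis cinner_scaleC_left scaleC_of_real)

lemma cinner_scaleR_right: "cinner x (r *\<^sub>R y) = of_real r * cinner x y"
  by (metis cinner_scaleC_right scaleC_of_real complex_cnj_complex_of_real)

lemma cinner_minus_left: "cinner (- x) y = - cinner x y"
  using cinner_scaleR_left[of "-1" x y] by simp

lemma cinner_minus_right: "cinner x (- y) = - cinner x y"
  using cinner_scaleR_right[of x "-1" y] by simp

lemma cinner_diff_left: "cinner (x - y) z = cinner x z - cinner y z"
  using cinner_add_left[of x "- y" z] by (simp add: cinner_minus_left)

lemma cinner_diff_right: "cinner x (y - z) = cinner x y - cinner x z"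
  using cinner_add_right[of x y "- z"] by (simp add: cinner_minus_right)

lemma cinner_zero_left: "cinner 0 x = 0"
  using cinner_diff_left[of 0 0 x] by simp

lemmas cinner_simps = cinner_add_left cinner_add_right cinner_diff_left cinner_diff_right
  cinner_scaleC_left cinner_scaleC_right cinner_scaleR_left cinner_scaleR_right
  cinner_minus_left cinner_minus_right

lemma cinner_self: "cinner x x = complex_of_real ((norm x)\<^sup>2)"
proof -
  obtain r where r: "cinner x x = complex_of_real r" "r \<ge> 0"
    using cinner_self_nonneg[of x] nonneg_Reals_cases by blast
  then have "(norm x)\<^sup>2 = r" by (simp add: norm_eq_sqrt_cinner)
  with r show ?thesis by simp
qed

lemma Re_cinner_self: "Re (cinner x x) = (norm x)\<^sup>2"
  by (simp add: cinner_self del: of_real_power)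

lemma Im_cinner_self: "Im (cinner x x) = 0"
  by (simp add: cinner_self del: of_real_power)

lemma Re_cinner_commute: "Re (cinner x y) = Re (cinner y x)"
  by (subst cinner_commute) simp

lemma norm_diff_squared:
  "(norm (x - y))\<^sup>2 = (norm x)\<^sup>2 - 2 * Re (cinner x y) + (norm (y::'a::complex_inner))\<^sup>2"
proof -
  have "Re (cinner (x - y) (x - y)) = (norm x)\<^sup>2 - 2 * Re (cinner x y) + (norm y)\<^sup>2"
    using Re_cinner_commute[of y x] by (simp add: cinner_simps Re_cinner_self)
  then show ?thesis by (simp add: Re_cinner_self)
qed

text \<open>The triangle inequality is part of the class, and squaring it gives Cauchy--Schwarz.\<close>

lemma Re_cinner_le: "Re (cinner x y) \<le> norm x * norm y"
proof -
  have "norm (x - (- y)) \<le> norm x + norm y"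
    using norm_triangle_ineq[of x y] by simp
  then have "(norm (x - (- y)))\<^sup>2 \<le> (norm x + norm y)\<^sup>2"
    by (simp add: power_mono)
  then show ?thesis
    unfolding norm_diff_squared by (simp add: cinner_minus_right power2_sum)
qed

lemma norm_scaleC: "norm (c *\<^sub>C x) = cmod c * norm (x::'a::complex_inner)"
proof -
  have "complex_of_real ((norm (c *\<^sub>C x))\<^sup>2) = of_real ((cmod c * norm x)\<^sup>2)"
    unfolding cinner_self[symmetric] power_mult_distrib of_real_mult complex_norm_square
    by (simp add: cinner_simps)
  then show ?thesis
    by (metis mult_nonneg_nonneg norm_ge_zero of_real_eq_iff power2_eq_iff_nonneg)
qed

lemma bounded_clinearD:
  assumes "bounded_clinear T"
  shows "T (x + y) = T x + T y" "T (x - y) = T x - T y" "T (r *\<^sub>R x) = r *\<^sub>R T x"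
    "T (c *\<^sub>C x) = c *\<^sub>C T x" "T 0 = 0" "bounded_linear T"
  using assms unfolding bounded_clinear_def
  by (auto simp: linear_add linear_diff linear_scale linear_0 bounded_linear.linear)

lemma bounded_clinear_pos_bounded:
  assumes "bounded_clinear T"
  obtains K where "K > 0" "\<And>x. norm (T x) \<le> K * norm x"
  using bounded_linear.pos_bounded[OF bounded_clinearD(6)[OF assms]] by (metis mult.commute)

lemma scaleC_diff_right: "c *\<^sub>C (x - y) = c *\<^sub>C x - c *\<^sub>C (y::'a::complex_inner)"
  using scaleC_add_right[of c "x - y" y] by (simp add: algebra_simps)

lemma bounded_clinearI:
  fixes T :: "'a::complex_inner \<Rightarrow> 'a"
  assumes "\<And>x y. T (x + y) = T x + T y" "\<And>c x. T (c *\<^sub>C x) = c *\<^sub>C T x"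
    "\<And>x. norm (T x) \<le> K * norm x"
  shows "bounded_clinear T"
proof -
  have "T (r *\<^sub>R x) = r *\<^sub>R T x" for r x
    using assms(2)[of "of_real r" x] by (simp add: scaleC_of_real)
  then have "bounded_linear T"
    using assms by (intro bounded_linear_intro[of T K]) (auto simp: mult.commute)
  then show ?thesis
    using assms(2) by (simp add: bounded_clinear_def)
qed

lemma bounded_clinear_ident: "bounded_clinear (\<lambda>x. x)"
  by (rule bounded_clinearI[where K = 1]) auto

lemma bounded_clinear_scaleC:
  assumes "bounded_clinear T"
  shows "bounded_clinear (\<lambda>x. c *\<^sub>C T x)"
proof -
  obtain K where "K > 0" and K: "\<And>x. norm (T x) \<le> K * norm x"
    using bounded_clinear_pos_bounded[OF assms] by blast
  have "norm (c *\<^sub>C T x) \<le> (cmod c * K) * norm x" for x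
    using mult_left_mono[OF K[of x], of "cmod c"] by (simp add: norm_scaleC)
  then show ?thesis
    by (intro bounded_clinearI[where K = "cmod c * K"])
      (simp_all add: bounded_clinearD[OF assms] scaleC_add_right scaleC_scaleC mult.commute[of c])
qed

lemma bounded_clinear_scaleR:
  "bounded_clinear T \<Longrightarrow> bounded_clinear (\<lambda>x. r *\<^sub>R T x)"
  using bounded_clinear_scaleC[of T "of_real r"] by (simp add: scaleC_of_real)

lemma bounded_clinear_add:
  assumes "bounded_clinear S" "bounded_clinear T"
  shows "bounded_clinear (\<lambda>x. S x + T x)"
  unfolding bounded_clinear_def
  using assms by (auto simp: bounded_clinearD bounded_linear_add scaleC_add_right)

lemma bounded_clinear_diff:
  assumes "bounded_clinear S" "bounded_clinear T"
  shows "bounded_clinear (\<lambda>x. S x - T x)"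
  unfolding bounded_clinear_def
  using assms by (auto simp: bounded_clinearD bounded_linear_sub scaleC_diff_right)

lemma bounded_clinear_compose:
  assumes "bounded_clinear S" "bounded_clinear T"
  shows "bounded_clinear (\<lambda>x. S (T x))"
  unfolding bounded_clinear_def
  using assms by (auto simp: bounded_clinearD bounded_linear_compose)

lemma bounded_clinear_diff_scaleC:
  "bounded_clinear T \<Longrightarrow> bounded_clinear (\<lambda>x. T x - z *\<^sub>C x)"
  by (intro bounded_clinear_diff bounded_clinear_scaleC bounded_clinear_ident)

definition selfadjoint_op :: "('a::complex_inner \<Rightarrow> 'a) \<Rightarrow> bool" where
  "selfadjoint_op T \<longleftrightarrow> bounded_clinear T \<and> (\<forall>x y. cinner (T x) y = cinner x (T y))"

lemma selfadjoint_op_clinear: "selfadjoint_op T \<Longrightarrow> bounded_clinear T"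
  and selfadjoint_op_cinner: "selfadjoint_op T \<Longrightarrow> cinner (T x) y = cinner x (T y)"
  by (auto simp: selfadjoint_op_def)

lemma selfadjoint_op_cinner_real: "selfadjoint_op T \<Longrightarrow> Im (cinner (T x) x) = 0"
  by (metis cinner_commute selfadjoint_op_cinner complex_cnj_cancel_iff Reals_cnj_iff complex_is_Real_iff)

text \<open>
  Polarization: realness of the form at \<open>x + y\<close> and at \<open>x + \<i>y\<close> determines both the imaginary and
  the real part of \<open>\<langle>Tx, y\<rangle>\<close> from \<open>\<langle>Ty, x\<rangle>\<close>.
\<close>

lemma positive_op_imp_selfadjoint:
  assumes T: "bounded_clinear T" and pos: "positive_op T"
  shows "selfadjoint_op T"
proof -
  have re: "Im (cinner (T v) v) = 0" for v
    using pos unfolding positive_op_def by (metis complex_is_Real_iff nonneg_Reals_subset_Reals subsetD)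
  have "cinner (T x) y = cinner x (T y)" for x y
  proof -
    have "Im (cinner (T x) y + cinner (T y) x) = 0"
      using re[of "x + y"] re[of x] re[of y] by (simp add: cinner_simps bounded_clinearD[OF T])
    moreover have "Im (cinner (T x) (\<i> *\<^sub>C y) + cinner (T (\<i> *\<^sub>C y)) x) = 0"
      using re[of "x + \<i> *\<^sub>C y"] re[of x] re[of "\<i> *\<^sub>C y"]
      by (simp add: cinner_simps bounded_clinearD[OF T])
    ultimately have "cinner (T x) y = cnj (cinner (T y) x)"
      by (auto simp: complex_eq_iff cinner_simps bounded_clinearD[OF T])
    then show ?thesis by (metis cinner_commute)
  qed
  with T show ?thesis by (simp add: selfadjoint_op_def)
qed

lemma selfadjoint_op_scaleR:
  "selfadjoint_op T \<Longrightarrow> selfadjoint_op (\<lambda>x. r *\<^sub>R T x)"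
  by (simp add: selfadjoint_op_def bounded_clinear_scaleR cinner_simps)

lemma selfadjoint_op_add:
  "selfadjoint_op S \<Longrightarrow> selfadjoint_op T \<Longrightarrow> selfadjoint_op (\<lambda>x. S x + T x)"
  by (simp add: selfadjoint_op_def bounded_clinear_add cinner_simps)

lemma selfadjoint_op_ident: "selfadjoint_op (\<lambda>x. x)"
  by (simp add: selfadjoint_op_def bounded_clinear_ident)

lemma selfadjoint_op_add_scaleR:
  "selfadjoint_op T \<Longrightarrow> selfadjoint_op (\<lambda>x. T x + r *\<^sub>R x)"
  by (intro selfadjoint_op_add selfadjoint_op_scaleR selfadjoint_op_ident)

section \<open>Coercivity and invertibility\<close>

lemma invertible_opI:
  assumes "bounded_clinear C" "bounded_clinear S" "\<And>x. S (C x) = x" "\<And>x. C (S x) = x"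
  shows "invertible_op C"
  using assms unfolding invertible_op_def by (auto simp: fun_eq_iff intro!: exI[of _ S])

text \<open>
  Lax--Milgram. For small \<open>t > 0\<close> the map \<open>x \<mapsto> x - tu(Cx - y)\<close> is a contraction, because
  \<open>\<parallel>v - tuCv\<parallel>\<^sup>2 \<le> (1 - 2td + t\<^sup>2K\<^sup>2)\<parallel>v\<parallel>\<^sup>2\<close> with \<open>K\<close> a bound for \<open>C\<close>; its fixed point solves \<open>Cx = y\<close>.
  The phase \<open>u\<close> lets the same lemma exclude nonreal spectrum and real spectrum on either side of the
  numerical range.
\<close>

lemma coercive_imp_invertible:
  fixes C :: "'a::chilbert_space \<Rightarrow> 'a"
  assumes C: "bounded_clinear C" and d: "d > 0" and u: "cmod u = 1"
    and coercive: "\<And>x. d * (norm x)\<^sup>2 \<le> Re (u * cinner (C x) x)"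
  shows "invertible_op C"
proof -
  obtain K0 where K0: "K0 > 0" "\<And>x. norm (C x) \<le> K0 * norm x"
    using bounded_clinear_pos_bounded[OF C] by blast
  \<comment> \<open>\<open>K \<ge> d\<close> makes the contraction constant \<open>sqrt (1 - d\<^sup>2/K\<^sup>2)\<close> at the optimal \<open>t = d/K\<^sup>2\<close> real.\<close>
  define K where "K = max K0 d"
  have K: "K > 0" "d \<le> K" "norm (C x) \<le> K * norm x" for x
    using K0(1) K0(2)[of x] mult_right_mono[of K0 K "norm x"] by (auto simp: K_def)
  have below: "d * norm x \<le> norm (C x)" for x
  proof -
    have "d * norm x * norm x \<le> Re (cinner (u *\<^sub>C C x) x)"
      using coercive[of x] by (simp add: cinner_simps power2_eq_square ac_simps)
    also have "\<dots> \<le> norm (C x) * norm x"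
      using Re_cinner_le[of "u *\<^sub>C C x" x] by (simp add: norm_scaleC u)
    finally show ?thesis
      by (cases "x = 0") auto
  qed
  have inj: "x = y" if "C x = C y" for x y
  proof -
    have "C (x - y) = 0" using that by (simp add: bounded_clinearD[OF C])
    with below[of "x - y"] d show ?thesis
      by (simp add: mult_le_0_iff)
  qed
  define t where "t = d / K\<^sup>2"
  define q where "q = sqrt (1 - d\<^sup>2 / K\<^sup>2)"
  have "d\<^sup>2 \<le> K\<^sup>2" using K d by (simp add: power_mono)
  then have q0: "0 \<le> 1 - d\<^sup>2 / K\<^sup>2" using K(1) by (simp add: field_simps)
  then have q: "0 \<le> q" "q < 1" "q\<^sup>2 = 1 - d\<^sup>2 / K\<^sup>2"
    using d K(1) by (auto simp: q_def)
  have contr: "norm (v - (of_real t * u) *\<^sub>C C v) \<le> q * norm v" for v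
  proof -
    let ?w = "(of_real t * u) *\<^sub>C C v"
    have "Re (cinner v ?w) = t * Re (u * cinner (C v) v)"
      unfolding Re_cinner_commute[of v] by (simp add: cinner_simps algebra_simps)
    moreover have "d * (norm v)\<^sup>2 * t \<le> t * Re (u * cinner (C v) v)"
      using coercive[of v] d K(1) by (simp add: t_def mult.commute mult_left_mono del: times_divide_eq_left times_divide_eq_right)
    moreover have "(norm ?w)\<^sup>2 \<le> t\<^sup>2 * (K\<^sup>2 * (norm v)\<^sup>2)"
      using power_mono[OF K(3)[of v], of 2]
      by (simp add: norm_scaleC norm_mult u power_mult_distrib mult_left_mono)
    ultimately have "(norm (v - ?w))\<^sup>2 \<le> (norm v)\<^sup>2 - 2 * (d * (norm v)\<^sup>2 * t) + t\<^sup>2 * (K\<^sup>2 * (norm v)\<^sup>2)"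
      unfolding norm_diff_squared by linarith
    also have "\<dots> = (1 - d\<^sup>2 / K\<^sup>2) * (norm v)\<^sup>2"
      using K(1) by (simp add: t_def field_simps power2_eq_square)
    also have "\<dots> = (q * norm v)\<^sup>2"
      by (simp add: q(3) power_mult_distrib)
    finally show ?thesis
      using q(1) by (meson mult_nonneg_nonneg norm_ge_zero power2_le_imp_le)
  qed
  have surj: "\<exists>x. C x = y" for y
  proof -
    let ?F = "\<lambda>x. x - (of_real t * u) *\<^sub>C (C x - y)"
    have "dist (?F v) (?F w) \<le> q * dist v w" for v w
    proof -
      have "?F v - ?F w = (v - w) - (of_real t * u) *\<^sub>C C (v - w)"
        by (simp add: bounded_clinearD(2)[OF C] scaleC_diff_right algebra_simps)
      then show ?thesis using contr[of "v - w"] by (simp only: dist_norm)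
    qed
    then obtain x where "?F x = x"
      using banach_fix_type[of q ?F] q by auto
    then have "(of_real t * u) *\<^sub>C (C x - y) = 0" by simp
    then have "cmod (of_real t * u) * norm (C x - y) = 0"
      by (metis norm_scaleC norm_zero)
    then have "C x - y = 0" using u d K(1) by (auto simp: t_def norm_mult)
    then show ?thesis by auto
  qed
  define S where "S = inv C"
  have CS: "C (S y) = y" for y using surj unfolding S_def by (metis f_inv_into_f rangeI)
  have SC: "S (C x) = x" for x using CS inj by blast
  have "norm (S y) \<le> (1 / d) * norm y" for y
    using below[of "S y"] d by (simp add: CS field_simps)
  moreover have "S (y + y') = S y + S y'" "S (c *\<^sub>C y) = c *\<^sub>C S y" for y y' c
    by (rule inj, simp add: bounded_clinearD[OF C] CS)+
  ultimately have "bounded_clinear S"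
    by (rule bounded_clinearI[rotated 2])
  then show ?thesis
    by (rule invertible_opI[OF C _ SC CS])
qed

lemma invertible_op_bounded_below:
  assumes "invertible_op C"
  obtains d where "d > 0" "\<And>x. d * norm x \<le> norm (C x)"
proof -
  obtain S where S: "bounded_clinear S" "S \<circ> C = id"
    using assms by (auto simp: invertible_op_def)
  obtain K where K: "K > 0" "\<And>x. norm (S x) \<le> K * norm x"
    using bounded_clinear_pos_bounded[OF S(1)] by blast
  have "(1 / K) * norm x \<le> norm (C x)" for x
    using K(2)[of "C x"] K(1) S(2) by (simp add: field_simps fun_eq_iff)
  with K(1) that[of "1 / K"] show thesis by simp
qed

lemma invertible_op_compose:
  assumes "invertible_op C" "invertible_op D"
  shows "invertible_op (\<lambda>x. C (D x))"
proof -
  obtain S R where S: "bounded_clinear S" "S \<circ> C = id" "C \<circ> S = id"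
    and R: "bounded_clinear R" "R \<circ> D = id" "D \<circ> R = id"
    using assms by (auto simp: invertible_op_def)
  have "bounded_clinear (\<lambda>x. C (D x))" "bounded_clinear (\<lambda>x. R (S x))"
    using assms S(1) R(1) by (auto simp: invertible_op_def bounded_clinear_compose)
  then show ?thesis
    by (rule invertible_opI) (metis S R comp_apply id_apply)+
qed

lemma invertible_op_scaleR:
  assumes "r \<noteq> 0"
  shows "invertible_op (\<lambda>x. r *\<^sub>R (x::'a::complex_inner))"
  using assms
  by (intro invertible_opI[where S = "\<lambda>x. (1 / r) *\<^sub>R x"] bounded_clinear_scaleR bounded_clinear_ident)
    auto

text \<open>
  Expanding \<open>\<langle>C(x - tCx), x - tCx\<rangle> \<ge> 0\<close> at \<open>t = 1/K\<close>, with \<open>K\<close> a bound for \<open>C\<close>, gives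
  \<open>\<parallel>Cx\<parallel>\<^sup>2 \<le> K\<langle>Cx, x\<rangle>\<close>. Hence a lower bound for \<open>\<parallel>Cx\<parallel>\<close>, which an inverse provides, is one for the form.
\<close>

lemma invertible_positive_imp_coercive:
  assumes C: "selfadjoint_op C" and pos: "\<And>x. 0 \<le> Re (cinner (C x) x)"
    and inv: "invertible_op C"
  obtains d where "d > 0" "\<And>x. d * (norm x)\<^sup>2 \<le> Re (cinner (C x) x)"
proof -
  note lin = bounded_clinearD[OF selfadjoint_op_clinear[OF C]]
  obtain K where K: "K > 0" "\<And>x. norm (C x) \<le> K * norm x"
    using bounded_clinear_pos_bounded[OF selfadjoint_op_clinear[OF C]] by blast
  obtain d where d: "d > 0" "\<And>x. d * norm x \<le> norm (C x)"
    using invertible_op_bounded_below[OF inv] by blast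
  have "(norm (C x))\<^sup>2 \<le> K * Re (cinner (C x) x)" for x
  proof -
    let ?t = "1 / K"
    have "Re (cinner (C (C x)) (C x)) \<le> K * (norm (C x))\<^sup>2"
      using Re_cinner_le[of "C (C x)" "C x"] mult_right_mono[OF K(2)[of "C x"], of "norm (C x)"]
      by (simp add: power2_eq_square mult.assoc)
    then have "?t\<^sup>2 * Re (cinner (C (C x)) (C x)) \<le> ?t\<^sup>2 * (K * (norm (C x))\<^sup>2)"
      by (intro mult_left_mono) auto
    also have "\<dots> = ?t * (norm (C x))\<^sup>2"
      using K(1) by (simp add: power2_eq_square)
    finally have A: "?t\<^sup>2 * Re (cinner (C (C x)) (C x)) \<le> ?t * (norm (C x))\<^sup>2" .
    have "0 \<le> Re (cinner (C (x - ?t *\<^sub>R C x)) (x - ?t *\<^sub>R C x))"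
      by (rule pos)
    also have "\<dots> = Re (cinner (C x) x) - 2 * ?t * (norm (C x))\<^sup>2 + ?t\<^sup>2 * Re (cinner (C (C x)) (C x))"
      using selfadjoint_op_cinner[OF C, of "C x" x] K(1)
      by (simp add: lin cinner_simps Re_cinner_self power2_eq_square diff_divide_distrib algebra_simps)
    finally have "?t * (norm (C x))\<^sup>2 \<le> Re (cinner (C x) x)" using A by linarith
    then show ?thesis using K(1) by (simp add: field_simps)
  qed
  moreover have "d\<^sup>2 * (norm x)\<^sup>2 \<le> (norm (C x))\<^sup>2" for x
    using power_mono[OF d(2)[of x], of 2] d(1) by (simp add: power_mult_distrib)
  ultimately have "d\<^sup>2 * (norm x)\<^sup>2 \<le> K * Re (cinner (C x) x)" for x
    by (meson order_trans)
  then have "d\<^sup>2 / K * (norm x)\<^sup>2 \<le> Re (cinner (C x) x)" for x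
    using K(1) by (simp add: pos_divide_le_eq mult.commute[of _ K])
  then show thesis using that[of "d\<^sup>2 / K"] d(1) K(1) by simp
qed

text \<open>
  Off the real interval \<open>[a, b]\<close> one of the phases \<open>\<plusminus>\<i>\<close>, \<open>\<plusminus>1\<close> makes \<open>T - z\<close> coercive.
\<close>

lemma spectrum_subset_interval:
  fixes T :: "'a::chilbert_space \<Rightarrow> 'a"
  assumes T: "selfadjoint_op T"
    and bounds: "\<And>x. a * (norm x)\<^sup>2 \<le> Re (cinner (T x) x)" "\<And>x. Re (cinner (T x) x) \<le> b * (norm x)\<^sup>2"
    and z: "z \<in> spectrum T"
  shows "Im z = 0" "a \<le> Re z" "Re z \<le> b"
proof -
  have clin: "bounded_clinear (\<lambda>x. T x - z *\<^sub>C x)"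
    using T by (intro bounded_clinear_diff_scaleC selfadjoint_op_clinear)
  have not_coercive: False
    if "d > 0" "cmod u = 1" "\<And>x. d * (norm x)\<^sup>2 \<le> Re (u * cinner (T x - z *\<^sub>C x) x)" for d u
    using coercive_imp_invertible[OF clin that] z by (simp add: spectrum_def)
  show "Im z = 0"
  proof (rule ccontr)
    assume "Im z \<noteq> 0"
    then show False
      using selfadjoint_op_cinner_real[OF T]
      by (intro not_coercive[of "\<bar>Im z\<bar>" "\<i> * of_real (sgn (Im z))"])
        (auto simp: cinner_simps Re_cinner_self Im_cinner_self norm_mult sgn_if)
  qed
  show "a \<le> Re z"
  proof (rule ccontr)
    assume "\<not> a \<le> Re z"
    then show False
      using bounds(1) by (intro not_coercive[of "a - Re z" 1]) (auto simp: cinner_simps Re_cinner_self Im_cinner_self algebra_simps)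
  qed
  show "Re z \<le> b"
  proof (rule ccontr)
    assume "\<not> Re z \<le> b"
    then show False
      using bounds(2) by (intro not_coercive[of "Re z - b" "-1"]) (auto simp: cinner_simps Re_cinner_self Im_cinner_self algebra_simps)
  qed
qed

text \<open>
  Otherwise \<open>s(T - \<mu>)\<close> would be positive and invertible, hence coercive, and the bound \<open>\<mu>\<close> could be improved.
  The sign of \<open>s\<close> distinguishes lower from upper bounds.
\<close>

lemma sharp_form_bound_in_spectrum:
  assumes T: "selfadjoint_op T" and s: "s \<noteq> 0"
    and pos: "\<And>x. 0 \<le> s * (Re (cinner (T x) x) - \<mu> * (norm x)\<^sup>2)"
    and sharp: "\<And>d. d > 0 \<Longrightarrow> \<exists>x. norm x = 1 \<and> s * (Re (cinner (T x) x) - \<mu>) < d"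
  shows "complex_of_real \<mu> \<in> spectrum T"
proof (rule ccontr)
  let ?C = "\<lambda>x. s *\<^sub>R (T x - of_real \<mu> *\<^sub>C x)"
  assume "complex_of_real \<mu> \<notin> spectrum T"
  then have "invertible_op (\<lambda>x. T x - of_real \<mu> *\<^sub>C x)" by (simp add: spectrum_def)
  then have inv: "invertible_op ?C" by (rule invertible_op_compose[OF invertible_op_scaleR[OF s]])
  have "selfadjoint_op (\<lambda>x. T x + (- \<mu>) *\<^sub>R x)" by (rule selfadjoint_op_add_scaleR[OF T])
  then have sa: "selfadjoint_op ?C"
    using selfadjoint_op_scaleR by (simp add: scaleC_of_real)
  have form: "Re (cinner (?C x) x) = s * (Re (cinner (T x) x) - \<mu> * (norm x)\<^sup>2)" for x
    by (simp add: cinner_simps Re_cinner_self)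
  obtain d where "d > 0" "\<And>x. d * (norm x)\<^sup>2 \<le> Re (cinner (?C x) x)"
    using invertible_positive_imp_coercive[OF sa _ inv] pos form by auto
  with sharp[OF \<open>d > 0\<close>] form show False
    by (metis linorder_not_less mult.right_neutral one_power2)
qed

lemma form_bounded:
  assumes "bounded_clinear T"
  obtains K where "\<And>x. - K * (norm x)\<^sup>2 \<le> Re (cinner (T x) x)" "\<And>x. Re (cinner (T x) x) \<le> K * (norm x)\<^sup>2"
proof -
  obtain K where K: "\<And>x. norm (T x) \<le> K * norm x"
    using bounded_clinear_pos_bounded[OF assms] by blast
  have "norm (T x) * norm x \<le> K * (norm x)\<^sup>2" for x
    using mult_right_mono[OF K[of x], of "norm x"] by (simp add: power2_eq_square mult.assoc)
  then have "\<bar>Re (cinner (T x) x)\<bar> \<le> K * (norm x)\<^sup>2" for x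
    using Re_cinner_le[of "T x" x] Re_cinner_le[of "- T x" x]
    by (simp add: cinner_minus_left abs_le_iff) (meson order_trans)
  then show thesis using that[of K] by (simp add: abs_le_iff minus_le_iff)
qed

lemma spectrum_selfadjoint_real:
  fixes T :: "'a::chilbert_space \<Rightarrow> 'a"
  assumes "selfadjoint_op T" "z \<in> spectrum T"
  shows "z = of_real (Re z)"
proof -
  obtain K where "\<And>x. - K * (norm x)\<^sup>2 \<le> Re (cinner (T x) x)" "\<And>x. Re (cinner (T x) x) \<le> K * (norm x)\<^sup>2"
    using form_bounded[OF selfadjoint_op_clinear[OF assms(1)]] by blast
  from spectrum_subset_interval(1)[OF assms(1) this assms(2)] show ?thesis
    by (simp add: complex_eq_iff)
qed

lemma form_normalize:
  assumes "bounded_clinear T"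
  shows "Re (cinner (T x) x) = (norm x)\<^sup>2 * Re (cinner (T (x /\<^sub>R norm x)) (x /\<^sub>R norm x))"
  by (cases "x = 0")
    (auto simp: bounded_clinearD[OF assms] cinner_zero_left cinner_simps power2_eq_square field_simps)

lemma bdd_form:
  assumes "bounded_clinear (T :: 'a::complex_inner \<Rightarrow> 'a)"
  shows "bdd_below ((\<lambda>x. Re (cinner (T x) x)) ` {x. norm x = 1})"
    "bdd_above ((\<lambda>x. Re (cinner (T x) x)) ` {x. norm x = 1})"
proof -
  obtain K where K: "\<And>x. - K * (norm x)\<^sup>2 \<le> Re (cinner (T x) x)" "\<And>x. Re (cinner (T x) x) \<le> K * (norm x)\<^sup>2"
    using form_bounded[OF assms] by blast
  show "bdd_below ((\<lambda>x. Re (cinner (T x) x)) ` {x. norm x = 1})"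
    by (rule bdd_belowI2[of _ "- K"]) (metis K(1) mem_Collect_eq mult.right_neutral one_power2)
  show "bdd_above ((\<lambda>x. Re (cinner (T x) x)) ` {x. norm x = 1})"
    by (rule bdd_aboveI2[of _ _ K]) (metis K(2) mem_Collect_eq mult.right_neutral one_power2)
qed

lemma Inf_form_le:
  assumes "bounded_clinear (T :: 'a::complex_inner \<Rightarrow> 'a)"
  shows "(INF x\<in>{x. norm x = 1}. Re (cinner (T x) x)) * (norm x)\<^sup>2 \<le> Re (cinner (T x) x)"
proof (cases "x = 0")
  case False
  then have "(INF x\<in>{x. norm x = 1}. Re (cinner (T x) x)) \<le> Re (cinner (T (x /\<^sub>R norm x)) (x /\<^sub>R norm x))"
    by (intro cINF_lower bdd_form assms) auto
  then show ?thesis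
    by (subst form_normalize[OF assms]) (simp add: mult.commute mult_left_mono)
qed (simp add: bounded_clinearD[OF assms] cinner_zero_left)

lemma Sup_form_ge:
  assumes "bounded_clinear (T :: 'a::complex_inner \<Rightarrow> 'a)"
  shows "Re (cinner (T x) x) \<le> (SUP x\<in>{x. norm x = 1}. Re (cinner (T x) x)) * (norm x)\<^sup>2"
proof (cases "x = 0")
  case False
  then have "Re (cinner (T (x /\<^sub>R norm x)) (x /\<^sub>R norm x)) \<le> (SUP x\<in>{x. norm x = 1}. Re (cinner (T x) x))"
    by (intro cSUP_upper bdd_form assms) auto
  then show ?thesis
    by (subst form_normalize[OF assms]) (simp add: mult.commute mult_left_mono)
qed (simp add: bounded_clinearD[OF assms] cinner_zero_left)

lemma unit_sphere_nonempty:
  assumes "(x::'a::complex_inner) \<noteq> 0"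
  shows "{x::'a. norm x = 1} \<noteq> {}"
proof -
  have "norm (x /\<^sub>R norm x) = 1" using assms by simp
  then show ?thesis by blast
qed

lemma Inf_form_in_spectrum:
  fixes T :: "'a::complex_inner \<Rightarrow> 'a"
  assumes T: "selfadjoint_op T" and nz: "(x0::'a) \<noteq> 0"
  shows "complex_of_real (INF x\<in>{x. norm x = 1}. Re (cinner (T x) x)) \<in> spectrum T"
proof (rule sharp_form_bound_in_spectrum[where s = 1])
  fix d :: real assume "d > 0"
  then have "(INF x\<in>{x. norm x = 1}. Re (cinner (T x) x)) < (INF x\<in>{x. norm x = 1}. Re (cinner (T x) x)) + d"
    by simp
  then show "\<exists>x. norm x = 1 \<and> 1 * (Re (cinner (T x) x) - (INF x\<in>{x. norm x = 1}. Re (cinner (T x) x))) < d"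
    by (subst (asm) cINF_less_iff[OF unit_sphere_nonempty[OF nz] bdd_form(1)[OF selfadjoint_op_clinear[OF T]]])
      auto
qed (use T Inf_form_le[OF selfadjoint_op_clinear[OF T]] in auto)

lemma Sup_form_in_spectrum:
  fixes T :: "'a::complex_inner \<Rightarrow> 'a"
  assumes T: "selfadjoint_op T" and nz: "(x0::'a) \<noteq> 0"
  shows "complex_of_real (SUP x\<in>{x. norm x = 1}. Re (cinner (T x) x)) \<in> spectrum T"
proof (rule sharp_form_bound_in_spectrum[where s = "-1"])
  fix d :: real assume "d > 0"
  then have "(SUP x\<in>{x. norm x = 1}. Re (cinner (T x) x)) - d < (SUP x\<in>{x. norm x = 1}. Re (cinner (T x) x))"
    by simp
  then show "\<exists>x. norm x = 1 \<and> - 1 * (Re (cinner (T x) x) - (SUP x\<in>{x. norm x = 1}. Re (cinner (T x) x))) < d"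
    by (subst (asm) less_cSUP_iff[OF unit_sphere_nonempty[OF nz] bdd_form(2)[OF selfadjoint_op_clinear[OF T]]])
      auto
qed (use T Sup_form_ge[OF selfadjoint_op_clinear[OF T]] in auto)

section \<open>Polynomials in a self-adjoint operator\<close>

lemma poly_op_eq_sum:
  assumes "degree p \<le> n"
  shows "poly_op p T x = (\<Sum>k\<le>n. coeff p k *\<^sub>R (T ^^ k) x)"
  unfolding poly_op_def using assms
  by (intro sum.mono_neutral_left) (auto simp: coeff_eq_0)

lemma poly_op_0: "poly_op 0 T x = 0"
  by (simp add: poly_op_def)

lemma poly_op_add: "poly_op (p + q) T x = poly_op p T x + poly_op q T x"
  unfolding poly_op_eq_sum[OF degree_add_le_max] poly_op_eq_sum[OF max.cobounded1[of "degree p" "degree q"]]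
    poly_op_eq_sum[OF max.cobounded2[of "degree q" "degree p"]]
  by (simp add: scaleR_add_left sum.distrib)

lemma poly_op_smult: "poly_op (smult c p) T x = c *\<^sub>R poly_op p T x"
  unfolding poly_op_eq_sum[OF degree_smult_le]
  by (simp add: poly_op_def scaleR_sum_right)

lemma poly_op_diff: "poly_op (p - q) T x = poly_op p T x - poly_op q T x"
  using poly_op_add[of "p - q" q T x] by simp

lemma poly_op_pCons:
  assumes "bounded_clinear T"
  shows "poly_op (pCons a p) T x = a *\<^sub>R x + T (poly_op p T x)"
proof -
  interpret T: bounded_linear T by (rule bounded_clinearD[OF assms])
  have "poly_op (pCons a p) T x = (\<Sum>k\<le>Suc (degree p). coeff (pCons a p) k *\<^sub>R (T ^^ k) x)"
    by (rule poly_op_eq_sum) (rule degree_pCons_le)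
  also have "\<dots> = a *\<^sub>R x + (\<Sum>k\<le>degree p. coeff p k *\<^sub>R T ((T ^^ k) x))"
    by (subst sum.atMost_Suc_shift) simp
  also have "\<dots> = a *\<^sub>R x + T (poly_op p T x)"
    by (simp add: poly_op_def T.sum T.scaleR)
  finally show ?thesis .
qed

lemma poly_op_mult:
  assumes "bounded_clinear T"
  shows "poly_op (p * q) T x = poly_op p T (poly_op q T x)"
  by (induction p)
    (simp_all add: poly_op_0 poly_op_add poly_op_smult poly_op_pCons[OF assms] bounded_clinearD[OF assms])

lemma poly_op_linear:
  assumes "bounded_clinear T"
  shows "poly_op [:a, 1:] T x = T x + a *\<^sub>R x"
  by (simp add: poly_op_0 poly_op_pCons[OF assms] bounded_clinearD[OF assms])

lemma poly_op_const:
  assumes "bounded_clinear T"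
  shows "poly_op [:a:] T x = a *\<^sub>R x"
  by (simp add: poly_op_0 poly_op_pCons[OF assms] bounded_clinearD[OF assms])

lemma poly_op_shift:
  assumes "bounded_clinear T"
  shows "poly_op (pcompose p [:d, 1:]) T x = poly_op p (\<lambda>x. T x + d *\<^sub>R x) x"
proof -
  have shift: "bounded_clinear (\<lambda>x. T x + d *\<^sub>R x)"
    using assms by (intro bounded_clinear_add bounded_clinear_scaleR bounded_clinear_ident)
  show ?thesis
    by (induction p)
      (simp_all only: pcompose_0 poly_op_0 pcompose_pCons poly_op_add poly_op_mult[OF assms]
        poly_op_linear[OF assms] poly_op_const[OF assms] poly_op_pCons[OF shift])
qed

lemma poly_op_selfadjoint:
  assumes T: "selfadjoint_op T"
  shows "selfadjoint_op (poly_op p T)"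
proof (induction p)
  case 0
  then show ?case
    using selfadjoint_op_scaleR[OF selfadjoint_op_ident, of 0] by (simp add: poly_op_0[abs_def])
next
  case (pCons a p)
  note clin = selfadjoint_op_clinear[OF T]
  have comm: "poly_op p T (T x) = T (poly_op p T x)" for x
    using poly_op_mult[OF clin, of p "[:0, 1:]" x] poly_op_mult[OF clin, of "[:0, 1:]" p x]
    by (simp only: mult.commute[of p] poly_op_linear[OF clin]) simp
  have "selfadjoint_op (\<lambda>x. T (poly_op p T x))"
    unfolding selfadjoint_op_def
    using bounded_clinear_compose[OF clin selfadjoint_op_clinear[OF pCons(2)]]
    by (simp add: selfadjoint_op_cinner[OF T] selfadjoint_op_cinner[OF pCons(2)] comm)
  then have "selfadjoint_op (\<lambda>x. a *\<^sub>R x + T (poly_op p T x))"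
    by (intro selfadjoint_op_add selfadjoint_op_scaleR selfadjoint_op_ident)
  then show ?case
    by (simp add: poly_op_pCons[OF clin, abs_def])
qed

lemma poly_of_real_add:
  "poly (map_poly complex_of_real (p + q)) z = poly (map_poly of_real p) z + poly (map_poly of_real q) z"
proof -
  have "map_poly complex_of_real (p + q) = map_poly of_real p + map_poly of_real q"
    by (rule poly_eqI) (simp add: coeff_map_poly)
  then show ?thesis by simp
qed

lemma poly_of_real_mult:
  "poly (map_poly complex_of_real (p * q)) z = poly (map_poly of_real p) z * poly (map_poly of_real q) z"
  by (induction p) (simp_all add: poly_of_real_add map_poly_pCons map_poly_smult algebra_simps)

text \<open>
  A real polynomial has at a nonreal root \<open>z\<close> the real quadratic factor \<open>(t - z)(t - z\<^sup>*)\<close>: the remainder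
  of the division by it is linear and vanishes at \<open>z\<close>.
\<close>

lemma nonreal_root_quadratic_dvd:
  fixes p :: "real poly"
  assumes z: "poly (map_poly of_real p) z = (0::complex)" and nonreal: "Im z \<noteq> 0"
  shows "[:(cmod z)\<^sup>2, - 2 * Re z, 1:] dvd p"
proof -
  let ?D = "[:(cmod z)\<^sup>2, - 2 * Re z, 1:]"
  define r where "r = p mod ?D"
  have D0: "poly (map_poly of_real ?D) z = 0"
    unfolding cmod_power2 by (simp add: map_poly_pCons complex_eq_iff algebra_simps power2_eq_square)
  have "p = ?D * (p div ?D) + r" by (simp only: r_def mult_div_mod_eq)
  then have "poly (map_poly of_real r) z = 0"
    using z D0 by (metis add_0 mult_zero_left poly_of_real_add poly_of_real_mult)
  moreover have "degree r \<le> 1"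
    using degree_mod_less[of ?D p] by (auto simp: r_def)
  then have r: "r = [:coeff r 0, coeff r 1:]"
    by (intro poly_eqI) (auto simp: coeff_pCons coeff_eq_0 split: nat.split)
  ultimately have "of_real (coeff r 0) + z * of_real (coeff r 1) = 0"
    by (metis (no_types, lifting) add.right_neutral map_poly_0 map_poly_pCons mult_zero_right of_real_0 poly_0 poly_pCons)
  then have "coeff r 1 = 0" "coeff r 0 = 0"
    using nonreal by (auto simp: complex_eq_iff)
  then have "r = 0" using r by simp
  then show ?thesis by (simp add: r_def dvd_eq_mod_eq_0)
qed

text \<open>
  Spectral mapping, in the direction that the calculus needs. A root of \<open>p\<close> splits off from \<open>p(T)\<close> an
  invertible factor: \<open>T - z\<close> if the root is real, \<open>(T - z)(T - z\<^sup>*)\<close> otherwise.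
\<close>

lemma invertible_poly_op:
  fixes T :: "'a::chilbert_space \<Rightarrow> 'a"
  assumes T: "selfadjoint_op T"
  shows "p \<noteq> 0 \<Longrightarrow> (\<And>t. t \<in> Re ` spectrum T \<Longrightarrow> poly p t \<noteq> 0) \<Longrightarrow> invertible_op (poly_op p T)"
proof (induction "degree p" arbitrary: p rule: less_induct)
  case less
  note clin = selfadjoint_op_clinear[OF T]
  have split: "invertible_op (poly_op p T)"
    if p: "p = d * q" and deg: "degree d > 0" and inv: "invertible_op (poly_op d T)" for d q
  proof -
    have nz: "d \<noteq> 0" "q \<noteq> 0" using less.prems(1) p by auto
    then have "degree q < degree p" using p deg by (simp add: degree_mult_eq)
    moreover have "poly q t \<noteq> 0" if "t \<in> Re ` spectrum T" for t
      using less.prems(2)[OF that] p by simp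
    ultimately have "invertible_op (poly_op q T)" using nz less.hyps by blast
    from invertible_op_compose[OF inv this] show ?thesis
      unfolding p poly_op_mult[OF clin, abs_def] .
  qed
  show ?case
  proof (cases "degree p = 0")
    case True
    then obtain a where "p = [:a:]" by (rule degree_eq_zeroE)
    then show ?thesis
      using less.prems(1) invertible_op_scaleR[of a] by (simp add: poly_op_const[OF clin, abs_def])
  next
    case False
    have "degree (map_poly complex_of_real p) = degree p" by (rule degree_map_poly) simp
    then obtain z where z: "poly (map_poly complex_of_real p) z = 0"
      using fundamental_theorem_of_algebra_alt[of "map_poly complex_of_real p"] False
      by (metis degree_pCons_0)
    show ?thesis
    proof (cases "Im z = 0")
      case True
      then have zr: "z = of_real (Re z)" by (simp add: complex_eq_iff)
      have root: "poly p (Re z) = 0"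
      proof -
        have "poly (map_poly complex_of_real p) (of_real (Re z)) = of_real (poly p (Re z))"
          by (induction p) (simp_all add: map_poly_pCons)
        with z zr show ?thesis by (metis of_real_eq_0_iff)
      qed
      then obtain q where q: "p = [:- Re z, 1:] * q" by (metis poly_eq_0_iff_dvd dvdE)
      have "z \<notin> spectrum T" using less.prems(2) root by blast
      then have "invertible_op (\<lambda>x. T x - of_real (Re z) *\<^sub>C x)"
        using zr by (simp add: spectrum_def)
      then have "invertible_op (poly_op [:- Re z, 1:] T)"
        by (simp add: poly_op_linear[OF clin, abs_def] scaleC_of_real)
      then show ?thesis by (intro split[OF q]) simp
    next
      case False
      let ?D = "[:(cmod z)\<^sup>2, - 2 * Re z, 1:]"
      obtain q where q: "p = ?D * q"
        using nonreal_root_quadratic_dvd[OF z False] by (metis dvdE)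
      have "z \<notin> spectrum T" "cnj z \<notin> spectrum T"
        using spectrum_selfadjoint_real[OF T] False
        by (metis Im_complex_of_real, metis Im_complex_of_real cnj.simps(2) neg_equal_0_iff_equal)
      then have "invertible_op (\<lambda>x. T x - z *\<^sub>C x)" "invertible_op (\<lambda>x. T x - cnj z *\<^sub>C x)"
        by (auto simp: spectrum_def)
      then have inv: "invertible_op (\<lambda>x. T (T x - cnj z *\<^sub>C x) - z *\<^sub>C (T x - cnj z *\<^sub>C x))"
        by (rule invertible_op_compose)
      have "T (T x - cnj z *\<^sub>C x) - z *\<^sub>C (T x - cnj z *\<^sub>C x) = poly_op ?D T x" for x
      proof -
        have "cnj z *\<^sub>C T x + z *\<^sub>C T x = (2 * Re z) *\<^sub>R T x"
          unfolding scaleC_add_left[symmetric] scaleC_of_real[symmetric]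
          by (simp add: complex_add_cnj add.commute)
        moreover have "z *\<^sub>C cnj z *\<^sub>C x = (cmod z)\<^sup>2 *\<^sub>R x"
          unfolding scaleC_scaleC scaleC_of_real[symmetric] complex_norm_square ..
        ultimately show ?thesis
          by (simp add: poly_op_pCons[OF clin] poly_op_0 bounded_clinearD[OF clin] scaleC_diff_right algebra_simps)
      qed
      then show ?thesis using inv by (intro split[OF q]) simp_all
    qed
  qed
qed

text \<open>
  A negative value of the form of \<open>p(T)\<close> would put the infimum \<open>\<mu> < 0\<close> of its numerical range into the
  spectrum of \<open>p(T)\<close>, although \<open>p - \<mu>\<close> has no zero in the spectrum of \<open>T\<close>.
\<close>

lemma poly_op_form_nonneg:
  fixes T :: "'a::chilbert_space \<Rightarrow> 'a"
  assumes T: "selfadjoint_op T" and p: "\<And>t. t \<in> Re ` spectrum T \<Longrightarrow> 0 \<le> poly p t"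
  shows "0 \<le> Re (cinner (poly_op p T x) x)"
proof (rule ccontr)
  define \<mu> where "\<mu> = (INF x\<in>{x. norm x = 1}. Re (cinner (poly_op p T x) x))"
  note clin = selfadjoint_op_clinear[OF T]
  assume neg: "\<not> 0 \<le> Re (cinner (poly_op p T x) x)"
  have B: "selfadjoint_op (poly_op p T)" by (rule poly_op_selfadjoint[OF T])
  have "x \<noteq> 0" using neg by (auto simp: cinner_zero_left bounded_clinearD[OF selfadjoint_op_clinear[OF B]])
  then have spec: "of_real \<mu> \<in> spectrum (poly_op p T)"
    unfolding \<mu>_def by (rule Inf_form_in_spectrum[OF B])
  have \<mu>: "\<mu> < 0"
    using Inf_form_le[OF selfadjoint_op_clinear[OF B], of x, folded \<mu>_def] neg
    by (smt (verit) mult_nonneg_nonneg zero_le_power2)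
  define q where "q = p - [:\<mu>:]"
  have "poly q t \<noteq> 0" if "t \<in> Re ` spectrum T" for t
    using p[OF that] \<mu> by (simp add: q_def)
  \<comment> \<open>Otherwise \<open>p\<close> is the negative constant \<open>\<mu>\<close>, but the spectrum is nonempty and \<open>p \<ge> 0\<close> there.\<close>
  moreover have "q \<noteq> 0"
  proof
    assume "q = 0"
    then have "p = [:\<mu>:]" by (simp add: q_def)
    have "Re ` spectrum T \<noteq> {}"
      using Inf_form_in_spectrum[OF T \<open>x \<noteq> 0\<close>] by blast
    then obtain t where "t \<in> Re ` spectrum T" by blast
    from p[OF this] \<mu> show False
      unfolding \<open>p = [:\<mu>:]\<close> by simp
  qed
  ultimately have "invertible_op (poly_op q T)"
    by (intro invertible_poly_op[OF T])
  then have "invertible_op (\<lambda>x. poly_op p T x - of_real \<mu> *\<^sub>C x)"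
    unfolding q_def by (simp add: poly_op_diff[abs_def] poly_op_const[OF clin] scaleC_of_real)
  then show False using spec by (simp add: spectrum_def)
qed

lemma norm_poly_op_le:
  fixes T :: "'a::chilbert_space \<Rightarrow> 'a"
  assumes T: "selfadjoint_op T" and c: "0 \<le> c" and p: "\<And>t. t \<in> Re ` spectrum T \<Longrightarrow> \<bar>poly p t\<bar> \<le> c"
  shows "norm (poly_op p T x) \<le> c * norm x"
proof -
  note clin = selfadjoint_op_clinear[OF T]
  have "0 \<le> poly ([:c\<^sup>2:] - p * p) t" if "t \<in> Re ` spectrum T" for t
    using power_mono[OF p[OF that], of 2] by (simp add: power2_eq_square)
  then have "0 \<le> Re (cinner (poly_op ([:c\<^sup>2:] - p * p) T x) x)"
    by (rule poly_op_form_nonneg[OF T])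
  moreover have "Re (cinner (poly_op p T (poly_op p T x)) x) = (norm (poly_op p T x))\<^sup>2"
    using selfadjoint_op_cinner[OF poly_op_selfadjoint[OF T]] by (metis Re_cinner_self)
  ultimately have "(norm (poly_op p T x))\<^sup>2 \<le> (c * norm x)\<^sup>2"
    by (simp add: poly_op_diff poly_op_const[OF clin] poly_op_mult[OF clin] cinner_simps Re_cinner_self
        power_mult_distrib)
  then show ?thesis by (rule power2_le_imp_le) (simp add: c)
qed

section \<open>The continuous functional calculus\<close>

lemma poly_op_sequences_close:
  fixes T :: "'a::chilbert_space \<Rightarrow> 'a"
  assumes T: "selfadjoint_op T"
    and p: "uniform_limit (Re ` spectrum T) (\<lambda>n. poly (p n)) f sequentially"
    and q: "uniform_limit (Re ` spectrum T) (\<lambda>n. poly (q n)) f sequentially"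
    and e: "e > 0"
  obtains N where "\<And>m n x. m \<ge> N \<Longrightarrow> n \<ge> N \<Longrightarrow> norm (poly_op (p m) T x - poly_op (q n) T x) \<le> e * norm x"
proof -
  have "\<forall>\<^sub>F n in sequentially. (\<forall>t\<in>Re ` spectrum T. dist (poly (p n) t) (f t) < e / 2) \<and>
      (\<forall>t\<in>Re ` spectrum T. dist (poly (q n) t) (f t) < e / 2)"
    by (intro eventually_conj uniform_limitD[OF p] uniform_limitD[OF q]) (use e in auto)
  then obtain N where N: "\<And>n t. n \<ge> N \<Longrightarrow> t \<in> Re ` spectrum T \<Longrightarrow>
      dist (poly (p n) t) (f t) < e / 2 \<and> dist (poly (q n) t) (f t) < e / 2"
    unfolding eventually_sequentially by blast
  have "norm (poly_op (p m) T x - poly_op (q n) T x) \<le> e * norm x" if "m \<ge> N" "n \<ge> N" for m n x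
    unfolding poly_op_diff[symmetric]
  proof (rule norm_poly_op_le[OF T])
    fix t assume "t \<in> Re ` spectrum T"
    from N[OF that(1) this] N[OF that(2) this] show "\<bar>poly (p m - q n) t\<bar> \<le> e"
      by (simp add: dist_real_def abs_if split: if_splits)
  qed (use e in simp)
  then show thesis by (rule that)
qed

text \<open>
  The definition of the calculus by a definite description is sound as soon as some sequence of
  polynomials converges to \<open>f\<close> uniformly on the spectrum: that sequence yields the operator, and any
  other such sequence is asymptotically close to it.
\<close>

lemma cfc_tendsto:
  fixes T :: "'a::chilbert_space \<Rightarrow> 'a"
  assumes T: "selfadjoint_op T"
    and p: "uniform_limit (Re ` spectrum T) (\<lambda>n. poly (p n)) f sequentially"
  shows "(\<lambda>n. poly_op (p n) T x) \<longlonglongrightarrow> cfc f T x"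
proof -
  have pclin: "bounded_clinear (poly_op q T)" for q
    by (intro selfadjoint_op_clinear poly_op_selfadjoint T)
  have "Cauchy (\<lambda>n. poly_op (p n) T x)" for x
  proof (rule CauchyI)
    fix e :: real assume e: "e > 0"
    then have e': "e / (norm x + 1) > 0"
      by (simp add: add_nonneg_pos)
    obtain N where N: "\<And>m n. m \<ge> N \<Longrightarrow> n \<ge> N \<Longrightarrow>
        norm (poly_op (p m) T x - poly_op (p n) T x) \<le> e / (norm x + 1) * norm x"
      using poly_op_sequences_close[OF T p p e'] by metis
    have "e / (norm x + 1) * norm x < e"
    proof -
      have "0 < norm x + 1" using norm_ge_zero[of x] by linarith
      then show ?thesis using e by (simp add: pos_divide_less_eq algebra_simps)
    qed
    with N show "\<exists>N. \<forall>m\<ge>N. \<forall>n\<ge>N. norm (poly_op (p m) T x - poly_op (p n) T x) < e"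
      by (meson le_less_trans)
  qed
  then have "\<exists>L. (\<lambda>n. poly_op (p n) T x) \<longlonglongrightarrow> L" for x
    using Cauchy_convergent convergent_def by metis
  then obtain S where S: "\<And>x. (\<lambda>n. poly_op (p n) T x) \<longlonglongrightarrow> S x"
    by metis
  have approx: "\<exists>N. \<forall>n\<ge>N. \<forall>x. norm (poly_op (q n) T x - S x) \<le> e * norm x"
    if q: "uniform_limit (Re ` spectrum T) (\<lambda>n. poly (q n)) f sequentially" and "e > 0" for q e
  proof -
    obtain N where N: "\<And>m n x. m \<ge> N \<Longrightarrow> n \<ge> N \<Longrightarrow>
        norm (poly_op (q m) T x - poly_op (p n) T x) \<le> e * norm x"
      using poly_op_sequences_close[OF T q p \<open>e > 0\<close>] by metis
    have "norm (poly_op (q m) T x - S x) \<le> e * norm x" if "m \<ge> N" for m x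
    proof (rule tendsto_upperbound)
      show "(\<lambda>n. norm (poly_op (q m) T x - poly_op (p n) T x)) \<longlonglongrightarrow> norm (poly_op (q m) T x - S x)"
        by (intro tendsto_intros S)
      show "\<forall>\<^sub>F n in sequentially. norm (poly_op (q m) T x - poly_op (p n) T x) \<le> e * norm x"
        by (rule eventually_sequentiallyI) (rule N[OF that])
    qed simp
    then show ?thesis by blast
  qed
  have Sclin: "bounded_clinear S"
  proof -
    obtain N where N: "\<And>x. norm (poly_op (p N) T x - S x) \<le> 1 * norm x"
      using approx[OF p, of 1] by auto
    obtain K where K: "\<And>x. norm (poly_op (p N) T x) \<le> K * norm x"
      using bounded_clinear_pos_bounded[OF pclin] by metis
    have bound: "norm (S x) \<le> (K + 1) * norm x" for x
      using norm_triangle_sub[of "S x" "poly_op (p N) T x"] N[of x] K[of x]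
      by (simp add: norm_minus_commute algebra_simps)
    have add: "S (x + y) = S x + S y" for x y
      using S[of "x + y"] tendsto_add[OF S[of x] S[of y]]
      unfolding bounded_clinearD(1)[OF pclin] by (rule LIMSEQ_unique)
    have scale: "S (c *\<^sub>C x) = c *\<^sub>C S x" for c x
    proof -
      have "(\<lambda>n. c *\<^sub>C poly_op (p n) T x) \<longlonglongrightarrow> c *\<^sub>C S x"
        by (rule bounded_linear.tendsto[OF _ S])
          (rule bounded_clinearD(6)[OF bounded_clinear_scaleC[OF bounded_clinear_ident]])
      with S[of "c *\<^sub>C x"] show ?thesis
        unfolding bounded_clinearD(4)[OF pclin] by (rule LIMSEQ_unique)
    qed
    show ?thesis by (rule bounded_clinearI[OF add scale bound])
  qed
  let ?P = "\<lambda>S. bounded_clinear S \<and> (\<forall>p :: nat \<Rightarrow> real poly.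
        uniform_limit (Re ` spectrum T) (\<lambda>n. poly (p n)) f sequentially \<longrightarrow>
        (\<lambda>n. onorm (\<lambda>x. poly_op (p n) T x - S x)) \<longlonglongrightarrow> 0)"
  have PS: "?P S"
  proof (intro conjI allI impI Sclin LIMSEQ_I)
    fix q :: "nat \<Rightarrow> real poly" and e :: real
    assume q: "uniform_limit (Re ` spectrum T) (\<lambda>n. poly (q n)) f sequentially" and "e > 0"
    then obtain N where N: "\<And>n x. n \<ge> N \<Longrightarrow> norm (poly_op (q n) T x - S x) \<le> e / 2 * norm x"
      using approx[OF q, of "e / 2"] by auto
    have "0 \<le> onorm (\<lambda>x. poly_op (q n) T x - S x) \<and> onorm (\<lambda>x. poly_op (q n) T x - S x) \<le> e / 2" if "n \<ge> N" for n
      using onorm_bound[OF _ N[OF that]] \<open>e > 0\<close>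
        onorm_pos_le[OF bounded_clinearD(6)[OF bounded_clinear_diff[OF pclin Sclin]]] by simp
    then show "\<exists>N. \<forall>n\<ge>N. norm (onorm (\<lambda>x. poly_op (q n) T x - S x) - 0) < e"
      using \<open>e > 0\<close> by (intro exI[of _ N]) force
  qed
  have lim: "(\<lambda>n. poly_op (p n) T x) \<longlonglongrightarrow> R x" if R: "?P R" for R x
  proof -
    have Rclin: "bounded_clinear R" using R by blast
    have lin: "bounded_linear (\<lambda>x. poly_op (p n) T x - R x)" for n
      by (rule bounded_clinearD(6)[OF bounded_clinear_diff[OF pclin Rclin]])
    have "(\<lambda>n. onorm (\<lambda>x. poly_op (p n) T x - R x) * norm x) \<longlonglongrightarrow> 0"
      using R p by (intro tendsto_mult_left_zero) blast
    then have "(\<lambda>n. poly_op (p n) T x - R x) \<longlonglongrightarrow> 0"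
      by (rule Lim_null_comparison[rotated]) (simp add: onorm[OF lin])
    then show ?thesis by (simp add: LIM_zero_iff)
  qed
  have "cfc f T = S"
    unfolding cfc_def
  proof (rule the_equality)
    show "?P S" by (rule PS)
    show "R = S" if "?P R" for R
      using lim[OF that] S LIMSEQ_unique by blast
  qed
  with S show ?thesis by simp
qed

lemma exists_poly_uniform_limit:
  fixes f :: "real \<Rightarrow> real"
  assumes "continuous_on {a..b} f"
  obtains p where "uniform_limit {a..b} (\<lambda>n. poly (p n)) f sequentially"
proof -
  obtain g where g: "uniform_limit {a..b} g f sequentially" "\<And>n. polynomial_function (g n)"
    using Stone_Weierstrass_uniform_limit[OF compact_Icc assms] by blast
  have "\<exists>p. g n = poly p" for n
  proof -
    obtain c m where "g n = (\<lambda>x. \<Sum>i\<le>m. c i * x ^ i)"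
      using g(2)[of n] by (auto simp: real_polynomial_function_eq[symmetric] real_polynomial_function_iff_sum)
    then have "g n = poly (\<Sum>i\<le>m. monom (c i) i)"
      by (simp add: poly_sum poly_monom fun_eq_iff)
    then show ?thesis by blast
  qed
  then obtain p where "\<And>n. g n = poly (p n)" by metis
  then have "g = (\<lambda>n. poly (p n))" by blast
  with g(1) that show thesis by blast
qed

text \<open>
  The inequality \<open>s w\<^sup>2 f + g \<ge> 0\<close> passes to the operators because it holds up to a small error for the
  polynomials that approximate \<open>f\<close>. One of the two factors \<open>w(T)\<close> moves to the other side of the form, by
  self-adjointness. The sign of \<open>s\<close> makes the lemma usable for lower and for upper bounds of \<open>f\<close>.
\<close>

lemma cfc_form_nonneg:
  fixes T :: "'a::chilbert_space \<Rightarrow> 'a" and s :: real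
  assumes T: "selfadjoint_op T" and spec: "Re ` spectrum T \<subseteq> {a..b}"
    and f: "continuous_on {a..b} f"
    and ineq: "\<And>t. a \<le> t \<Longrightarrow> t \<le> b \<Longrightarrow> 0 \<le> poly g t + s * (poly w t)\<^sup>2 * f t"
  shows "0 \<le> Re (cinner (poly_op g T x) x) +
    s * Re (cinner (cfc f T (poly_op w T x)) (poly_op w T x))"
    (is "0 \<le> ?L")
proof -
  note clin = selfadjoint_op_clinear[OF T]
  obtain p where p: "uniform_limit {a..b} (\<lambda>n. poly (p n)) f sequentially"
    using exists_poly_uniform_limit[OF f] by blast
  let ?y = "poly_op w T x"
  define P where "P n = g + smult s (w * (p n * w))" for n
  have form: "Re (cinner (poly_op (P n) T x) x) =
      Re (cinner (poly_op g T x) x) + s * Re (cinner (poly_op (p n) T ?y) ?y)" for n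
    by (simp add: P_def poly_op_add poly_op_smult poly_op_mult[OF clin] cinner_simps
        selfadjoint_op_cinner[OF poly_op_selfadjoint[OF T], of w])
  have "(\<lambda>n. poly_op (p n) T ?y) \<longlonglongrightarrow> cfc f T ?y"
    using uniform_limit_on_subset[OF p spec] by (rule cfc_tendsto[OF T])
  moreover have "bounded_linear (\<lambda>z. Re (cinner z ?y))"
    using Re_cinner_le[of _ ?y] Re_cinner_le[of "- _" ?y]
    by (intro bounded_linear_intro[where K = "norm ?y"])
      (auto simp: cinner_simps abs_le_iff cinner_minus_left)
  ultimately have "(\<lambda>n. Re (cinner (poly_op (p n) T ?y) ?y)) \<longlonglongrightarrow> Re (cinner (cfc f T ?y) ?y)"
    by (rule bounded_linear.tendsto[rotated])
  then have lim: "(\<lambda>n. Re (cinner (poly_op (P n) T x) x)) \<longlonglongrightarrow> ?L"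
    unfolding form by (rule tendsto_add[OF tendsto_const tendsto_mult_left])
  have "bounded (poly w ` {a..b})"
    by (intro compact_imp_bounded compact_continuous_image continuous_intros) auto
  then obtain C where C: "C > 0" "\<And>t. a \<le> t \<Longrightarrow> t \<le> b \<Longrightarrow> \<bar>poly w t\<bar> \<le> C"
    unfolding bounded_pos by auto
  have "- (e * (norm x)\<^sup>2) \<le> ?L" if e: "e > 0" for e
  proof (rule tendsto_lowerbound[OF lim])
    \<comment> \<open>If \<open>p n\<close> is within \<open>d\<close> of \<open>f\<close>, then \<open>P n\<close> is at least \<open>-e\<close> on the spectrum.\<close>
    define d where "d = e / ((\<bar>s\<bar> + 1) * C\<^sup>2)"
    have "d > 0" using e C(1) by (simp add: d_def add_nonneg_pos)
    show "\<forall>\<^sub>F n in sequentially. - (e * (norm x)\<^sup>2) \<le> Re (cinner (poly_op (P n) T x) x)"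
      using uniform_limitD[OF p \<open>d > 0\<close>]
    proof eventually_elim
      case (elim n)
      have "0 \<le> poly (P n + [:e:]) t" if "t \<in> Re ` spectrum T" for t
      proof -
        have t: "a \<le> t" "t \<le> b" using that spec by auto
        then have pf: "\<bar>poly (p n) t - f t\<bar> \<le> d" using elim by (auto simp: dist_real_def less_imp_le)
        have "(poly w t)\<^sup>2 \<le> C\<^sup>2" using C(2)[OF t] power_mono[of "\<bar>poly w t\<bar>" C 2] by simp
        then have "\<bar>s\<bar> * (poly w t)\<^sup>2 * \<bar>poly (p n) t - f t\<bar> \<le> (\<bar>s\<bar> + 1) * C\<^sup>2 * d"
          using pf by (intro mult_mono) auto
        also have "\<dots> = e" using C(1) by (simp add: d_def)
        finally have "\<bar>s * (poly w t)\<^sup>2 * (poly (p n) t - f t)\<bar> \<le> e" by (simp add: abs_mult)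
        then have "- e \<le> s * (poly w t)\<^sup>2 * (poly (p n) t - f t)" by (simp add: abs_le_iff)
        then show ?thesis
          using ineq[OF t] by (simp add: P_def algebra_simps power2_eq_square)
      qed
      then have "0 \<le> Re (cinner (poly_op (P n + [:e:]) T x) x)"
        by (rule poly_op_form_nonneg[OF T])
      then show ?case
        by (simp add: poly_op_add poly_op_const[OF clin] cinner_simps Re_cinner_self)
    qed
  qed simp
  then have "0 \<le> ?L + e" if "e > 0" for e
  proof -
    have "0 < e / ((norm x)\<^sup>2 + 1)" using that by (simp add: add_nonneg_pos)
    from \<open>\<And>e. e > 0 \<Longrightarrow> - (e * (norm x)\<^sup>2) \<le> ?L\<close>[OF this]
    have "- (e / ((norm x)\<^sup>2 + 1) * (norm x)\<^sup>2) \<le> ?L" .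
    moreover have "e / ((norm x)\<^sup>2 + 1) * (norm x)\<^sup>2 \<le> e"
    proof -
      have "0 < (norm x)\<^sup>2 + 1" by (simp add: add_nonneg_pos)
      then show ?thesis using that by (simp only: times_divide_eq_left pos_divide_le_eq) (simp add: distrib_left)
    qed
    ultimately show ?thesis by linarith
  qed
  then show ?thesis by (metis add.commute le_add_same_cancel1 field_le_epsilon add_0)
qed

lemma cfc_diff:
  fixes T :: "'a::chilbert_space \<Rightarrow> 'a"
  assumes T: "selfadjoint_op T" and spec: "Re ` spectrum T \<subseteq> {a..b}"
    and f: "continuous_on {a..b} f" and h: "continuous_on {a..b} h"
  shows "cfc (\<lambda>t. h t - f t) T x = cfc h T x - cfc f T x"
proof -
  obtain p where p: "uniform_limit (Re ` spectrum T) (\<lambda>n. poly (p n)) f sequentially"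
    using exists_poly_uniform_limit[OF f] uniform_limit_on_subset[OF _ spec] by metis
  obtain q where q: "uniform_limit (Re ` spectrum T) (\<lambda>n. poly (q n)) h sequentially"
    using exists_poly_uniform_limit[OF h] uniform_limit_on_subset[OF _ spec] by metis
  have "uniform_limit (Re ` spectrum T) (\<lambda>n. poly (q n - p n)) (\<lambda>t. h t - f t) sequentially"
    using uniform_limit_minus[OF q p] by (simp add: poly_diff[abs_def])
  from cfc_tendsto[OF T this, of x] tendsto_diff[OF cfc_tendsto[OF T q, of x] cfc_tendsto[OF T p, of x]]
  show ?thesis unfolding poly_op_diff by (rule LIMSEQ_unique)
qed

lemma cfc_shift:
  fixes T :: "'a::chilbert_space \<Rightarrow> 'a"
  assumes T: "selfadjoint_op T" and spec: "Re ` spectrum T \<subseteq> {a..b}"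
    and spec': "Re ` spectrum (\<lambda>x. T x + d *\<^sub>R x) \<subseteq> {a + d..b + d}"
    and f: "continuous_on {a + d..b + d} f"
  shows "cfc f (\<lambda>x. T x + d *\<^sub>R x) x = cfc (\<lambda>t. f (t + d)) T x"
proof -
  obtain p where p: "uniform_limit {a + d..b + d} (\<lambda>n. poly (p n)) f sequentially"
    using exists_poly_uniform_limit[OF f] by blast
  have "(\<lambda>n. poly_op (p n) (\<lambda>x. T x + d *\<^sub>R x) x) \<longlonglongrightarrow> cfc f (\<lambda>x. T x + d *\<^sub>R x) x"
    using uniform_limit_on_subset[OF p spec'] by (rule cfc_tendsto[OF selfadjoint_op_add_scaleR[OF T]])
  moreover have "(\<lambda>n. poly_op (pcompose (p n) [:d, 1:]) T x) \<longlonglongrightarrow> cfc (\<lambda>t. f (t + d)) T x"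
  proof (rule cfc_tendsto[OF T], rule uniform_limitI)
    fix e :: real assume "e > 0"
    show "\<forall>\<^sub>F n in sequentially. \<forall>t\<in>Re ` spectrum T. dist (poly (p n \<circ>\<^sub>p [:d, 1:]) t) (f (t + d)) < e"
      using uniform_limitD[OF p \<open>e > 0\<close>]
    proof eventually_elim
      case (elim n)
      show ?case
      proof
        fix t assume "t \<in> Re ` spectrum T"
        then have "t + d \<in> {a + d..b + d}" using spec by auto
        with elim show "dist (poly (p n \<circ>\<^sub>p [:d, 1:]) t) (f (t + d)) < e"
          by (simp add: poly_pcompose add.commute)
      qed
    qed
  qed
  ultimately show ?thesis
    unfolding poly_op_shift[OF selfadjoint_op_clinear[OF T]] by (rule LIMSEQ_unique)
qed

section \<open>Bounds for the logarithm and the determinant\<close>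

lemma spectrum_shift_subset:
  fixes T :: "'a::chilbert_space \<Rightarrow> 'a"
  assumes T: "selfadjoint_op T"
    and bounds: "\<And>x. a * (norm x)\<^sup>2 \<le> Re (cinner (T x) x)" "\<And>x. Re (cinner (T x) x) \<le> b * (norm x)\<^sup>2"
  shows "Re ` spectrum (\<lambda>x. T x + d *\<^sub>R x) \<subseteq> {a + d..b + d}"
proof -
  have "(a + d) * (norm x)\<^sup>2 \<le> Re (cinner (T x + d *\<^sub>R x) x)"
    "Re (cinner (T x + d *\<^sub>R x) x) \<le> (b + d) * (norm x)\<^sup>2" for x
    using bounds[of x] by (auto simp: cinner_simps Re_cinner_self algebra_simps)
  from spectrum_subset_interval(2,3)[OF selfadjoint_op_add_scaleR[OF T] this] show ?thesis
    by auto
qed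

abbreviation log_value :: "('a::complex_inner \<Rightarrow> 'a) \<Rightarrow> real \<Rightarrow> 'a \<Rightarrow> real" where
  "log_value A \<epsilon> x \<equiv> Re (cinner (log_op (\<lambda>y. A y + \<epsilon> *\<^sub>R y) x) x)"

text \<open>
  The spectrum of \<open>A + \<epsilon>I\<close> lies in \<open>[m + \<epsilon>, \<infinity>)\<close>, away from the singularity of \<open>ln\<close>, so that the transfer of
  inequalities applies to the logarithm.
\<close>

lemma log_value_form_nonneg:
  fixes A :: "'a::chilbert_space \<Rightarrow> 'a"
  assumes A: "selfadjoint_op A"
    and m: "\<And>x. m * (norm x)\<^sup>2 \<le> Re (cinner (A x) x)" "0 \<le> m" and \<epsilon>: "0 < \<epsilon>"
    and ineq: "\<And>t. m + \<epsilon> \<le> t \<Longrightarrow> 0 \<le> poly g t + s * (poly w t)\<^sup>2 * ln t"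
  shows "0 \<le> Re (cinner (poly_op g (\<lambda>y. A y + \<epsilon> *\<^sub>R y) x) x) +
    s * log_value A \<epsilon> (poly_op w (\<lambda>y. A y + \<epsilon> *\<^sub>R y) x)"
proof -
  obtain M where M: "\<And>x. Re (cinner (A x) x) \<le> M * (norm x)\<^sup>2"
    using form_bounded[OF selfadjoint_op_clinear[OF A]] by metis
  show ?thesis
    unfolding log_op_def
  proof (rule cfc_form_nonneg[OF selfadjoint_op_add_scaleR[OF A] spectrum_shift_subset[OF A m(1) M]])
    show "continuous_on {m + \<epsilon>..M + \<epsilon>} ln"
      using m(2) \<epsilon> by (intro continuous_on_ln continuous_on_id) auto
  qed (rule ineq)
qed

text \<open>The tangent of \<open>ln\<close> at the mean value yields Jensen's inequality.\<close>

lemma log_value_le: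
  fixes A :: "'a::chilbert_space \<Rightarrow> 'a"
  assumes A: "selfadjoint_op A" and pos: "\<And>x. 0 \<le> Re (cinner (A x) x)" and \<epsilon>: "0 < \<epsilon>" and x: "norm x = 1"
  shows "log_value A \<epsilon> x \<le> ln (Re (cinner (A x) x) + \<epsilon>)"
proof -
  let ?T = "\<lambda>y. A y + \<epsilon> *\<^sub>R y"
  define c where "c = Re (cinner (A x) x) + \<epsilon>"
  have c: "c > 0" using pos[of x] \<epsilon> by (simp add: c_def)
  have Tclin: "bounded_clinear ?T" by (rule selfadjoint_op_clinear[OF selfadjoint_op_add_scaleR[OF A]])
  have "0 \<le> Re (cinner (poly_op [:ln c - 1, 1 / c:] ?T x) x) + (- 1) * log_value A \<epsilon> (poly_op [:1:] ?T x)"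
  proof (rule log_value_form_nonneg[OF A _ order_refl \<epsilon>])
    fix t assume "0 + \<epsilon> \<le> t"
    then have t: "t > 0" using \<epsilon> by simp
    have "ln t = ln c + ln (t / c)" using t c by (simp add: ln_div)
    also have "\<dots> \<le> ln c + (t / c - 1)" using t c by (simp add: ln_le_minus_one)
    finally show "0 \<le> poly [:ln c - 1, 1 / c:] t + - 1 * (poly [:1:] t)\<^sup>2 * ln t" by simp
  qed (use pos in simp)
  also have "Re (cinner (poly_op [:ln c - 1, 1 / c:] ?T x) x) = ln c - 1 + (1 / c) * c"
    by (simp add: poly_op_pCons[OF Tclin] poly_op_0 bounded_clinearD[OF selfadjoint_op_clinear[OF A]]
        cinner_simps Re_cinner_self x c_def add_divide_distrib[symmetric])
  finally show ?thesis
    using c by (simp add: poly_op_const[OF Tclin] c_def)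
qed

lemma log_value_ge:
  fixes A :: "'a::chilbert_space \<Rightarrow> 'a"
  assumes A: "selfadjoint_op A" and m: "\<And>x. m * (norm x)\<^sup>2 \<le> Re (cinner (A x) x)" "0 < m"
    and \<epsilon>: "0 < \<epsilon>" and x: "norm x = 1"
  shows "ln m \<le> log_value A \<epsilon> x"
proof -
  let ?T = "\<lambda>y. A y + \<epsilon> *\<^sub>R y"
  have Tclin: "bounded_clinear ?T" by (rule selfadjoint_op_clinear[OF selfadjoint_op_add_scaleR[OF A]])
  have "0 \<le> Re (cinner (poly_op [:- ln m:] ?T x) x) + 1 * log_value A \<epsilon> (poly_op [:1:] ?T x)"
    using m(2) \<epsilon> by (intro log_value_form_nonneg[OF A m(1)]) auto
  then show ?thesis
    by (simp add: poly_op_const[OF Tclin] cinner_simps Re_cinner_self x)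
qed

text \<open>
  This is the estimate behind the supremum. The logarithm of \<open>A\<close> may be unbounded below, so that a vector on
  which \<open>A\<close> is nearly maximal can have a small determinant. On the range of \<open>A\<close> the weight \<open>u\<^sup>2\<close> compensates:
  \<open>u\<^sup>2 (ln u - ln c) \<ge> (u\<^sup>2 - c\<^sup>2) / 2\<close>, by \<open>ln v \<ge> 1 - 1/v\<close> at \<open>v = u\<^sup>2/c\<^sup>2\<close>. For \<open>c = \<parallel>Az\<parallel>/\<parallel>z\<parallel>\<close> the right-hand
  side has mean value zero at \<open>z\<close>.
\<close>

lemma log_value_range_ge:
  fixes A :: "'a::chilbert_space \<Rightarrow> 'a"
  assumes A: "selfadjoint_op A" and pos: "\<And>x. 0 \<le> Re (cinner (A x) x)" and \<epsilon>: "0 < \<epsilon>"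
    and c: "0 < c" and z: "norm (A z) = c * norm z"
  shows "ln c * (norm (A z))\<^sup>2 \<le> log_value A \<epsilon> (A z)"
proof -
  let ?T = "\<lambda>y. A y + \<epsilon> *\<^sub>R y"
  let ?w = "[:- \<epsilon>, 1:]"
  let ?g = "[:c\<^sup>2 / 2:] - smult (1 / 2 + ln c) (?w * ?w)"
  have T: "selfadjoint_op ?T" by (rule selfadjoint_op_add_scaleR[OF A])
  note Tclin = selfadjoint_op_clinear[OF T]
  have w: "poly_op ?w ?T y = A y" for y
    by (simp add: poly_op_linear[OF Tclin])
  have "0 \<le> Re (cinner (poly_op ?g ?T z) z) + 1 * log_value A \<epsilon> (poly_op ?w ?T z)"
  proof (rule log_value_form_nonneg[OF A _ order_refl \<epsilon>])
    fix t assume t: "0 + \<epsilon> \<le> t"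
    define u where "u = t - \<epsilon>"
    have "(u\<^sup>2 - c\<^sup>2) / 2 \<le> u\<^sup>2 * (ln t - ln c)"
    proof (cases "u = 0")
      case False
      then have u: "u > 0" "u \<le> t" using t \<epsilon> by (auto simp: u_def)
      have "ln (c\<^sup>2 / u\<^sup>2) \<le> c\<^sup>2 / u\<^sup>2 - 1" using u c by (intro ln_le_minus_one) auto
      then have "(1 - c\<^sup>2 / u\<^sup>2) / 2 \<le> ln u - ln c"
        using u c by (simp add: ln_div ln_realpow)
      also have "\<dots> \<le> ln t - ln c" using u by simp
      finally have "u\<^sup>2 * ((1 - c\<^sup>2 / u\<^sup>2) / 2) \<le> u\<^sup>2 * (ln t - ln c)"
        by (rule mult_left_mono) simp
      then show ?thesis using u by (simp add: right_diff_distrib)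
    qed simp
    moreover have "poly ?w t = u" by (simp add: u_def)
    ultimately show "0 \<le> poly ?g t + 1 * (poly ?w t)\<^sup>2 * ln t"
      unfolding poly_diff poly_smult poly_mult by (simp add: power2_eq_square algebra_simps diff_divide_distrib)
  qed (use pos in simp)
  moreover have "Re (cinner (poly_op ?g ?T z) z) = - ln c * (norm (A z))\<^sup>2"
  proof -
    have "Re (cinner (poly_op (?w * ?w) ?T z) z) = (norm (A z))\<^sup>2"
      unfolding poly_op_mult[OF Tclin] w
      using selfadjoint_op_cinner[OF A, of "A z" z] by (simp add: Re_cinner_self)
    then show ?thesis
      unfolding poly_op_diff poly_op_smult poly_op_const[OF Tclin] cinner_simps
      by (simp add: Re_cinner_self z power_mult_distrib algebra_simps)
  qed
  ultimately show ?thesis by (simp add: w)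
qed

text \<open>
  \<open>A + \<delta>I\<close> and \<open>A + \<epsilon>I\<close> have different spectra. They are compared as the two functions \<open>ln (t + (\<delta> - \<epsilon>))\<close> and
  \<open>ln t\<close> of the single operator \<open>A + \<epsilon>I\<close>.
\<close>

lemma log_value_mono:
  fixes A :: "'a::chilbert_space \<Rightarrow> 'a"
  assumes A: "selfadjoint_op A" and pos: "\<And>x. 0 \<le> Re (cinner (A x) x)"
    and \<epsilon>: "0 < \<epsilon>" "\<epsilon> \<le> \<delta>"
  shows "log_value A \<epsilon> x \<le> log_value A \<delta> x"
proof -
  let ?T = "\<lambda>y. A y + \<epsilon> *\<^sub>R y" and ?d = "\<delta> - \<epsilon>"
  have T: "selfadjoint_op ?T" by (rule selfadjoint_op_add_scaleR[OF A])
  obtain M where M: "\<And>x. Re (cinner (A x) x) \<le> M * (norm x)\<^sup>2"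
    using form_bounded[OF selfadjoint_op_clinear[OF A]] by metis
  have pos0: "0 * (norm x)\<^sup>2 \<le> Re (cinner (A x) x)" for x using pos by simp
  have spec: "Re ` spectrum ?T \<subseteq> {\<epsilon>..M + \<epsilon>}"
    using spectrum_shift_subset[OF A pos0 M, of \<epsilon>] by simp
  have eq: "(\<lambda>y. ?T y + ?d *\<^sub>R y) = (\<lambda>y. A y + \<delta> *\<^sub>R y)"
    by (simp add: fun_eq_iff scaleR_left_diff_distrib)
  have spec': "Re ` spectrum (\<lambda>y. ?T y + ?d *\<^sub>R y) \<subseteq> {\<epsilon> + ?d..M + \<epsilon> + ?d}"
    using spectrum_shift_subset[OF A pos0 M, of \<delta>] unfolding eq by simp
  have cont: "continuous_on {\<epsilon>..M + \<epsilon>} ln" "continuous_on {\<epsilon>..M + \<epsilon>} (\<lambda>t. ln (t + ?d))"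
    "continuous_on {\<epsilon> + ?d..M + \<epsilon> + ?d} ln"
    using \<epsilon> by (auto intro!: continuous_on_ln continuous_intros)
  have logd: "log_op (\<lambda>y. A y + \<delta> *\<^sub>R y) x = cfc (\<lambda>t. ln (t + ?d)) ?T x"
    using cfc_shift[OF T spec spec' cont(3), of x] unfolding eq log_op_def .
  have "0 \<le> Re (cinner (poly_op 0 ?T x) x) +
    1 * Re (cinner (cfc (\<lambda>t. ln (t + ?d) - ln t) ?T (poly_op [:1:] ?T x)) (poly_op [:1:] ?T x))"
    by (rule cfc_form_nonneg[OF T spec continuous_on_diff[OF cont(2,1)]]) (use \<epsilon> in auto)
  then show ?thesis
    unfolding logd cfc_diff[OF T spec cont(1,2)]
    by (simp add: poly_op_0 poly_op_const[OF selfadjoint_op_clinear[OF T]] cinner_simps cinner_zero_left log_op_def)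
qed

text \<open>Monotonicity in \<open>\<epsilon>\<close> makes the limit exist and turns it into an infimum.\<close>

lemma log_form_eq_INF:
  fixes A :: "'a::chilbert_space \<Rightarrow> 'a"
  assumes A: "selfadjoint_op A" and pos: "\<And>x. 0 \<le> Re (cinner (A x) x)"
  shows "log_form A x = (INF \<epsilon>\<in>{0<..}. ereal (log_value A \<epsilon> x))" (is "_ = ?I")
  unfolding log_form_def
proof (rule tendsto_Lim)
  show "((\<lambda>\<epsilon>. ereal (log_value A \<epsilon> x)) \<longlongrightarrow> ?I) (at_right 0)"
  proof (rule order_tendstoI)
    fix a assume a: "a < ?I"
    have "a < ereal (log_value A \<epsilon> x)" if "0 < \<epsilon>" for \<epsilon>
      using that by (intro less_INF_D[OF a]) simp
    then show "\<forall>\<^sub>F \<epsilon> in at_right 0. a < ereal (log_value A \<epsilon> x)"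
      using eventually_at_right_less[of 0] by (auto elim: eventually_mono)
  next
    fix a assume "?I < a"
    then obtain \<delta> where \<delta>: "\<delta> > 0" "ereal (log_value A \<delta> x) < a"
      by (auto simp: INF_less_iff)
    have "\<forall>\<^sub>F \<epsilon> in at_right 0. 0 < \<epsilon> \<and> \<epsilon> < \<delta>"
      using \<delta>(1) by (auto simp: eventually_at_right)
    then show "\<forall>\<^sub>F \<epsilon> in at_right 0. ereal (log_value A \<epsilon> x) < a"
    proof eventually_elim
      case (elim \<epsilon>)
      then have "ereal (log_value A \<epsilon> x) \<le> ereal (log_value A \<delta> x)"
        using log_value_mono[OF A pos] by simp
      with \<delta>(2) show ?case by (meson le_less_trans)
    qed
  qed
qed simp

lemma fs_det_nonneg: "0 \<le> fs_det A x"
  by (simp add: fs_det_def exp_ereal_def)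

lemma fs_det_ge:
  fixes A :: "'a::chilbert_space \<Rightarrow> 'a"
  assumes A: "selfadjoint_op A" and pos: "\<And>x. 0 \<le> Re (cinner (A x) x)"
    and c: "0 < c" and ge: "\<And>\<epsilon>. 0 < \<epsilon> \<Longrightarrow> ln c \<le> log_value A \<epsilon> x"
  shows "c \<le> fs_det A x"
proof -
  have "ereal (ln c) \<le> log_form A x"
    unfolding log_form_eq_INF[OF A pos] using ge by (auto intro: INF_greatest)
  moreover have "log_form A x \<le> ereal (log_value A 1 x)"
    unfolding log_form_eq_INF[OF A pos] by (rule INF_lower) simp
  ultimately obtain l where "log_form A x = ereal l" "ln c \<le> l"
    by (cases "log_form A x") auto
  moreover from this(2) have "exp (ln c) \<le> exp l" by simp
  ultimately show ?thesis using c by (simp add: fs_det_def exp_ereal_def)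
qed

lemma fs_det_le_form:
  fixes A :: "'a::chilbert_space \<Rightarrow> 'a"
  assumes A: "selfadjoint_op A" and pos: "\<And>x. 0 \<le> Re (cinner (A x) x)" and x: "norm x = 1"
  shows "fs_det A x \<le> Re (cinner (A x) x)"
proof (rule field_le_epsilon)
  fix \<epsilon> :: real assume \<epsilon>: "0 < \<epsilon>"
  define c where "c = Re (cinner (A x) x) + \<epsilon>"
  have c: "c > 0" using pos[of x] \<epsilon> by (simp add: c_def)
  have "log_form A x \<le> ereal (log_value A \<epsilon> x)"
    unfolding log_form_eq_INF[OF A pos] using \<epsilon> by (intro INF_lower) simp
  also have "\<dots> \<le> ereal (ln c)"
    using log_value_le[OF A pos \<epsilon> x] by (simp add: c_def)
  finally have "log_form A x \<le> ereal (ln c)" .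
  then have "fs_det A x \<le> c"
    using c by (cases "log_form A x") (auto simp: fs_det_def exp_ereal_def ln_ge_iff)
  then show "fs_det A x \<le> Re (cinner (A x) x) + \<epsilon>" by (simp add: c_def)
qed

text \<open>If \<open>Ay \<noteq> 0\<close>, the vector is \<open>Ay/\<parallel>Ay\<parallel>\<close>; its determinant is even at least \<open>\<parallel>Ay\<parallel>\<close>.\<close>

lemma exists_fs_det_ge_form:
  fixes A :: "'a::chilbert_space \<Rightarrow> 'a"
  assumes A: "selfadjoint_op A" and pos: "\<And>x. 0 \<le> Re (cinner (A x) x)" and y: "norm y = 1"
  obtains x where "norm x = 1" "Re (cinner (A y) y) \<le> fs_det A x"
proof (cases "A y = 0")
  case True
  then show thesis using that[of y] y fs_det_nonneg[of A y] by (simp add: cinner_zero_left)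
next
  case False
  define c where "c = norm (A y)"
  define z where "z = y /\<^sub>R c"
  have c: "c > 0" using False by (simp add: c_def)
  have Az: "A z = A y /\<^sub>R c"
    by (simp add: z_def bounded_clinearD[OF selfadjoint_op_clinear[OF A]])
  have unit: "norm (A z) = 1" using c by (simp add: Az c_def)
  have z: "norm (A z) = c * norm z" using c y unfolding unit by (simp add: z_def)
  have "c \<le> fs_det A (A z)"
    using log_value_range_ge[OF A pos _ c z] by (intro fs_det_ge[OF A pos c]) (simp add: unit)
  moreover have "Re (cinner (A y) y) \<le> c"
    using Re_cinner_le[of "A y" y] y by (simp add: c_def)
  ultimately show thesis using that[OF unit] by linarith
qed

theorem proposition2p5:
  fixes A :: "'a::chilbert_space \<Rightarrow> 'a"
  assumes "\<exists>x::'a. x \<noteq> 0"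
    and "bounded_clinear A"
    and "positive_op A"
  shows "(INF x\<in>{x. norm x = 1}. fs_det A x) = (INF x\<in>{x. norm x = 1}. Re (cinner (A x) x)) \<and>
    (INF x\<in>{x. norm x = 1}. Re (cinner (A x) x)) = Inf (Re ` spectrum A) \<and>
    (SUP x\<in>{x. norm x = 1}. fs_det A x) = (SUP x\<in>{x. norm x = 1}. Re (cinner (A x) x)) \<and>
    (SUP x\<in>{x. norm x = 1}. Re (cinner (A x) x)) = Sup (Re ` spectrum A)"
proof -
  let ?U = "{x::'a. norm x = 1}"
  define m where "m = (INF x\<in>?U. Re (cinner (A x) x))"
  define M where "M = (SUP x\<in>?U. Re (cinner (A x) x))"
  obtain x0 :: 'a where x0: "x0 \<noteq> 0" using assms(1) by blast
  have U: "?U \<noteq> {}" by (rule unit_sphere_nonempty[OF x0])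
  have A: "selfadjoint_op A" by (rule positive_op_imp_selfadjoint[OF assms(2,3)])
  have pos: "0 \<le> Re (cinner (A x) x)" for x
    using assms(3) unfolding positive_op_def by (metis complex_nonneg_Reals_iff)
  note m_le = Inf_form_le[OF assms(2), folded m_def] and le_M = Sup_form_ge[OF assms(2), folded M_def]
  have spec: "z \<in> Re ` spectrum A \<Longrightarrow> m \<le> z \<and> z \<le> M" for z
    using spectrum_subset_interval[OF A m_le le_M] by auto
  have "m \<in> Re ` spectrum A" "M \<in> Re ` spectrum A"
    using Inf_form_in_spectrum[OF A x0] Sup_form_in_spectrum[OF A x0]
    by (force simp: m_def M_def intro: image_eqI[where f = Re])+
  then have Inf: "m = Inf (Re ` spectrum A)" and Sup: "M = Sup (Re ` spectrum A)"
    using spec by (auto intro!: cInf_eq_minimum[symmetric] cSup_eq_maximum[symmetric])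
  have bdd: "bdd_below (fs_det A ` ?U)" "bdd_above (fs_det A ` ?U)"
  proof -
    show "bdd_below (fs_det A ` ?U)" by (rule bdd_belowI2[of _ 0]) (rule fs_det_nonneg)
    show "bdd_above (fs_det A ` ?U)"
    proof (rule bdd_aboveI2[of _ _ M])
      fix x :: 'a assume "x \<in> ?U"
      then show "fs_det A x \<le> M"
        using fs_det_le_form[OF A pos, of x] le_M[of x] by simp
    qed
  qed
  have "(INF x\<in>?U. fs_det A x) = m"
  proof (rule antisym)
    show "(INF x\<in>?U. fs_det A x) \<le> m"
      unfolding m_def using fs_det_le_form[OF A pos] by (intro cINF_mono U bdd) auto
    show "m \<le> (INF x\<in>?U. fs_det A x)"
    proof (rule cINF_greatest[OF U])
      fix x :: 'a assume x: "x \<in> ?U"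
      show "m \<le> fs_det A x"
      proof (cases "m > 0")
        case True
        then show ?thesis
          using log_value_ge[OF A m_le True] x by (intro fs_det_ge[OF A pos]) auto
      qed (use fs_det_nonneg[of A x] in linarith)
    qed
  qed
  moreover have "(SUP x\<in>?U. fs_det A x) = M"
  proof (rule antisym)
    show "(SUP x\<in>?U. fs_det A x) \<le> M"
      unfolding M_def using fs_det_le_form[OF A pos] by (intro cSUP_mono U bdd_form assms(2)) auto
    show "M \<le> (SUP x\<in>?U. fs_det A x)"
      unfolding M_def
    proof (rule cSUP_mono[OF U bdd(2)])
      fix y :: 'a assume "y \<in> ?U"
      then show "\<exists>x\<in>?U. Re (cinner (A y) y) \<le> fs_det A x"
        using exists_fs_det_ge_form[OF A pos, of y] by auto
    qed
  qed
  ultimately show ?thesis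
    using Inf Sup by (simp add: m_def M_def)
qed

end
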